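(* The tableau calculus $\mathcal T_{\mathcal{SO}}$ is sound and constructively complete for the description logic $\mathcal{SO}$. Furthermore, $\mathcal T_{\mathcal{SO}}$ is terminating provided that conditions (c1) and (c2) (stated in the context) are both true for $\mathcal T_{\mathcal{SO}}$-derivations.
   Context: **The logic $\mathcal{SO}$.** There are countably many individual variables $\ell_0,\ell_1,\dots$, concept symbols $p_0,p_1,\dots$ and role symbols $r_0,r_1,\dots$. Concepts: $C::=p\mid\{\ell\}\mid\neg C\mid C\vee D\mid\exists r.C$. An $\mathcal{SO}$-model $\mathcal I$ has a non-empty domain $\Delta^{\mathcal I}$, assigns to each individual an element of $\Delta^{\mathcal I}$, to each concept symbol a subset of $\Delta^{\mathcal I}$, to each role symbol a transitive binary relation on $\Delta^{\mathcal I}$, and interprets $\{\ell\}$ as the singleton of the element assigned to $\ell$, $\neg,\vee$ as complement and union, and $\exists r.C$ as $\{x\mid\exists y\,((x,y)\in r^{\mathcal I}\wedge y\in C^{\mathcal I})\}$. A set $\mathcal S$ of concepts is satisfiable if some element of some model lies in $C^{\mathcal I}$ for all $C\in\mathcal S$. For the tableau calculus the language is extended by a connective $\ell:C$ (true at every point iff the element denoted by $\ell$ is in $C^{\mathcal I}$) and by individual terms $f(r,C,\ell)$ ($r$ a role symbol, $C$ a concept, $\ell$ an individual term), which are again individuals and may occur in $\{\cdot\}$. **Tableaux.** Rules have the form $X_0/X_1\mid\cdots\mid X_n$ ($\bot$ if $n=0$, a closure rule). For an input set $\mathcal S$ of concepts the root of a tableau is $\{a:C\mid C\in\mathcal S\}$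 with $a$ a fresh individual. Applying a rule to a node containing instances of all its premises creates $n$ successors, the $i$-th adding the instance of $X_i$; each rule is applied at most once to the same premises. $T(\mathcal S)$ is a finished tableau (all applicable rules have been applied on all branches, in the limit). A branch is a maximal path, identified with the union of its nodes; it is closed if a closure rule has been applied on it and open otherwise; a tableau is closed if all its branches are closed, otherwise open. **Rules of $\mathcal T_{\mathcal{SO}}$** ($\ell,\ell',\ell''$ range over individual terms, $p,q$ over concepts, $r$ over role symbols): $\ell:\neg\neg p\,/\,\ell:p$; $\ell:(p\vee q)\,/\,\ell:p\mid\ell:q$; $\ell:\neg(p\vee q)\,/\,\ell:\neg p,\ \ell:\neg q$; $\ell:\exists r.p\,/\,\ell:\exists r.\{f(r,p,\ell)\},\ f(r,p,\ell):p$; $\ell:\neg\exists r.p,\ \ell:\exists r.\{\ell'\}\,/\,\ell':\neg p$; $\ell:\exists r.\{\ell'\},\ \ell':\exists r.\{\ell''\}\,/\,\ell:\exists r.\{\ell''\}$; $\ell:\{\ell'\}\,/\,\ell':\{\ell\}$; $\ell:\neg\{\ell'\}\,/\,\ell':\{\ell'\}$; $\ell:p\,/\,\ell:\{\ell\}$; $\ell:\neg\exists r.\{\ell'\}\,/\,\ell':\{\ell'\}$; $\ell:p,\ \ell:\{\ell'\}\,/\,\ell':p$; $\ell:\exists r.\{\ell'\},\ \ell':\{\ell''\}\,/\,\ell:\exists r.\{\ell''\}$; $f(r,p,\ell):\{f(r,p,\ell)\},\ \ell:\{\ell'\}\,/\,f(r,p,\ell):\{f(r,p,\ell')\}$; closure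 rule $\ell:p,\ \ell:\neg p\,/\,\bot$; unrestricted blocking rule (ub$'$): $\ell:\{\ell\},\ \ell':\{\ell'\}\,/\,\ell:\{\ell'\}\mid\ell:\neg\{\ell'\}$. **Properties.** Sound: for every (possibly infinite) satisfiable set $\mathcal S$ of concepts, every $T(\mathcal S)$ is open. Constructively complete: for every set $\mathcal S$ of concepts and every open branch $\mathcal B$ of a $T(\mathcal S)$ there is an $\mathcal{SO}$-model $\mathcal I$ (interpreting individual terms as well) whose domain is the set of equivalence classes $\|t\|$ of individual terms $t$ occurring in $\mathcal B$ under $t\sim t'$ iff $t:\{t'\}\in\mathcal B$, with each such $t$ denoting $\|t\|$, and such that $\|t\|\in C^{\mathcal I}$ whenever $t:C\in\mathcal B$. Terminating: for every finite set $\mathcal S$ of concepts, every closed tableau $T(\mathcal S)$ is finite and every open tableau $T(\mathcal S)$ has a finite open branch. **Conditions.** Let $<$ be an ordering of the individual terms in a branch that is a linear extension of the order of their introduction in the derivation ($t<t'$ whenever the first appearance of $t'$ is strictly later than that of $t$). The only rule producing new terms is $\ell:\exists r.p\,/\,\ell:\exists r.\{f(r,p,\ell)\},\,f(r,p,\ell):p$. (c1) If $t:\{t'\}$ appears in a branch and $t<t'$, then possible applications of term-producing rules to formulae with the term $t'$ are not performed. (c2) In every open branch there is some node from which point onwards, before any application of a term-producing rule, all possible applications of (ub$'$) have been performed.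
   Formalization: ∼ is made reflexive and the root individual counts as occurring; the f-congruence rule counts as term-producing when it adds a new term; (c1) looks at labels and at u in t:{u}, t:∃r.{u}; (c2) requires (ub') for all pairs of labels, even if t:{t} is not yet derived. *)

theory Defs
  imports Main "HOL-Library.Sublist"
begin

section \<open>The logic SO\<close>

text \<open>Concept and role symbols are natural numbers. The type of individuals is a parameter:
  \<open>nat concept\<close> is the language of SO (individual variables are natural numbers), and
  \<open>iterm concept\<close> below is the language extended by individual terms.\<close>

datatype 'i concept =
    Con nat
  | Nom 'i
  | Neg "'i concept"
  | Or "'i concept" "'i concept"
  | Ex nat "'i concept"

record ('i, 'd) interp =
  domain :: "'d set"
  ind :: "'i \<Rightarrow> 'd"
  con :: "nat \<Rightarrow> 'd set"
  rol :: "nat \<Rightarrow> ('d \<times> 'd) set"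

definition so_model :: "('i, 'd) interp \<Rightarrow> bool" where
  "so_model I \<longleftrightarrow> domain I \<noteq> {} \<and> (\<forall>i. ind I i \<in> domain I) \<and> (\<forall>p. con I p \<subseteq> domain I) \<and>
     (\<forall>r. rol I r \<subseteq> domain I \<times> domain I \<and> trans (rol I r))"

primrec ext :: "('i, 'd) interp \<Rightarrow> 'i concept \<Rightarrow> 'd set" where
  "ext I (Con p) = con I p"
| "ext I (Nom i) = {ind I i}"
| "ext I (Neg C) = domain I - ext I C"
| "ext I (Or C D) = ext I C \<union> ext I D"
| "ext I (Ex r C) = {x. \<exists>y. (x, y) \<in> rol I r \<and> y \<in> ext I C}"

text \<open>HOL cannot quantify over types inside a formula, so the type carrying the domain is an
  explicit parameter, left free (hence universally quantified) in soundness.\<close>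

definition satisfiable :: "'d itself \<Rightarrow> nat concept set \<Rightarrow> bool" where
  "satisfiable _ S \<longleftrightarrow> (\<exists>(I :: (nat, 'd) interp) x. so_model I \<and> x \<in> domain I \<and> (\<forall>C\<in>S. x \<in> ext I C))"


section \<open>Individual terms and labelled formulae\<close>

text \<open>\<open>New\<close> is an individual outside the language of SO; it keeps a fresh individual available
  even if the input mentions every individual variable.\<close>

datatype iterm = Ind nat | New | Fn nat "iterm concept" iterm

text \<open>\<open>At t C\<close> is the formula written \<open>t : C\<close>. SO inputs do not contain the connective and the rules
  produce it only outermost, so it is not a constructor of concepts.\<close>

datatype fml = At iterm "iterm concept"

primrec subterms :: "iterm \<Rightarrow> iterm set" where
  "subterms (Ind n) = {Ind n}"
| "subterms New = {New}"
| "subterms (Fn r C t) = insert (Fn r C t) (subterms t \<union> \<Union> (set_concept (map_concept subterms C)))"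

primrec fml_terms :: "fml \<Rightarrow> iterm set" where
  "fml_terms (At t C) = subterms t \<union> \<Union> (subterms ` set_concept C)"

definition terms :: "fml set \<Rightarrow> iterm set" where
  "terms L = \<Union> (fml_terms ` L)"

definition label_terms :: "fml set \<Rightarrow> iterm set" where
  "label_terms L = {t. \<exists>C. At t C \<in> L}"

definition fresh :: "nat concept set \<Rightarrow> iterm \<Rightarrow> bool" where
  "fresh S a \<longleftrightarrow> a = New \<or> (\<exists>n. a = Ind n \<and> (\<forall>C\<in>S. n \<notin> set_concept C))"

text \<open>A model interpreting individual terms interprets \<open>f(r,C,_)\<close> as a function on the domain.\<close>

definition term_model :: "(iterm, 'd) interp \<Rightarrow> bool" where
  "term_model I \<longleftrightarrow> so_model I \<and>
     (\<forall>r C t t'. ind I t = ind I t' \<longrightarrow> ind I (Fn r C t) = ind I (Fn r C t'))"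


section \<open>The rules\<close>

datatype rule_name =
    NegNeg | OrRule | NegOr | ExRule | NegEx | TransRule | SymRule | ReflNegNom | ReflLabel
  | ReflNegEx | CongLabel | CongEx | CongFn | Closure | UB

text \<open>\<open>inst \<rho> Ps Xs\<close>: rule \<open>\<rho>\<close> has an instance with premises \<open>Ps\<close> and conclusions \<open>Xs\<close>, one set for
  each successor. The conclusions are determined by the rule and the list of premises.\<close>

inductive inst :: "rule_name \<Rightarrow> fml list \<Rightarrow> fml set list \<Rightarrow> bool" where
  "inst NegNeg [At l (Neg (Neg p))] [{At l p}]"
| "inst OrRule [At l (Or p q)] [{At l p}, {At l q}]"
| "inst NegOr [At l (Neg (Or p q))] [{At l (Neg p), At l (Neg q)}]"
| "inst ExRule [At l (Ex r p)] [{At l (Ex r (Nom (Fn r p l))), At (Fn r p l) p}]"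
| "inst NegEx [At l (Neg (Ex r p)), At l (Ex r (Nom l'))] [{At l' (Neg p)}]"
| "inst TransRule [At l (Ex r (Nom l')), At l' (Ex r (Nom l''))] [{At l (Ex r (Nom l''))}]"
| "inst SymRule [At l (Nom l')] [{At l' (Nom l)}]"
| "inst ReflNegNom [At l (Neg (Nom l'))] [{At l' (Nom l')}]"
| "inst ReflLabel [At l p] [{At l (Nom l)}]"
| "inst ReflNegEx [At l (Neg (Ex r (Nom l')))] [{At l' (Nom l')}]"
| "inst CongLabel [At l p, At l (Nom l')] [{At l' p}]"
| "inst CongEx [At l (Ex r (Nom l')), At l' (Nom l'')] [{At l (Ex r (Nom l''))}]"
| "inst CongFn [At (Fn r p l) (Nom (Fn r p l)), At l (Nom l')] [{At (Fn r p l) (Nom (Fn r p l'))}]"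
| "inst Closure [At l p, At l (Neg p)] []"
| "inst UB [At l (Nom l), At l' (Nom l')] [{At l (Nom l')}, {At l (Neg (Nom l'))}]"


section \<open>Tableaux\<close>

text \<open>A tableau is a possibly infinite tree whose nodes are addresses: the successors of \<open>x\<close> are
  \<open>x @ [0]\<close>, \<open>x @ [1]\<close>, and so on. \<open>applied\<close> records the rule and premises used at a node.\<close>

record tableau =
  root_ind :: iterm
  nodes :: "nat list set"
  formulas :: "nat list \<Rightarrow> fml set"
  applied :: "nat list \<Rightarrow> (rule_name \<times> fml list) option"

definition expansion :: "tableau \<Rightarrow> nat list \<Rightarrow> rule_name \<Rightarrow> fml list \<Rightarrow> fml set list \<Rightarrow> bool" where
  "expansion T x \<rho> Ps Xs \<longleftrightarrow> inst \<rho> Ps Xs \<and> set Ps \<subseteq> formulas T x \<and>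
     (\<forall>y. strict_prefix y x \<longrightarrow> applied T y \<noteq> Some (\<rho>, Ps)) \<and>
     (\<forall>i. x @ [i] \<in> nodes T \<longleftrightarrow> i < length Xs) \<and>
     (\<forall>i < length Xs. formulas T (x @ [i]) = formulas T x \<union> Xs ! i)"

definition is_tableau :: "nat concept set \<Rightarrow> tableau \<Rightarrow> bool" where
  "is_tableau S T \<longleftrightarrow>
     fresh S (root_ind T) \<and>
     [] \<in> nodes T \<and> formulas T [] = (\<lambda>C. At (root_ind T) (map_concept Ind C)) ` S \<and>
     (\<forall>x i. x @ [i] \<in> nodes T \<longrightarrow> x \<in> nodes T) \<and>
     (\<forall>x\<in>nodes T. case applied T x of
         None \<Rightarrow> (\<forall>i. x @ [i] \<notin> nodes T)
       | Some (\<rho>, Ps) \<Rightarrow> (\<exists>Xs. expansion T x \<rho> Ps Xs))"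

definition is_path :: "tableau \<Rightarrow> nat list set \<Rightarrow> bool" where
  "is_path T B \<longleftrightarrow> B \<subseteq> nodes T \<and> (\<forall>x\<in>B. \<forall>y\<in>B. prefix x y \<or> prefix y x)"

definition branch :: "tableau \<Rightarrow> nat list set \<Rightarrow> bool" where
  "branch T B \<longleftrightarrow> is_path T B \<and> (\<forall>B'. is_path T B' \<and> B \<subseteq> B' \<longrightarrow> B' = B)"

definition branch_fmls :: "tableau \<Rightarrow> nat list set \<Rightarrow> fml set" where
  "branch_fmls T B = \<Union> (formulas T ` B)"

definition applied_on :: "tableau \<Rightarrow> nat list set \<Rightarrow> rule_name \<Rightarrow> fml list \<Rightarrow> bool" where
  "applied_on T B \<rho> Ps \<longleftrightarrow> (\<exists>x\<in>B. applied T x = Some (\<rho>, Ps))"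

definition closed_branch :: "tableau \<Rightarrow> nat list set \<Rightarrow> bool" where
  "closed_branch T B \<longleftrightarrow> (\<exists>Ps. applied_on T B Closure Ps)"

definition open_branch :: "tableau \<Rightarrow> nat list set \<Rightarrow> bool" where
  "open_branch T B \<longleftrightarrow> branch T B \<and> \<not> closed_branch T B"

definition closed_tableau :: "tableau \<Rightarrow> bool" where
  "closed_tableau T \<longleftrightarrow> (\<forall>B. branch T B \<longrightarrow> closed_branch T B)"

definition finished :: "tableau \<Rightarrow> bool" where
  "finished T \<longleftrightarrow> (\<forall>B \<rho> Ps Xs. open_branch T B \<and> inst \<rho> Ps Xs \<and> set Ps \<subseteq> branch_fmls T B \<longrightarrow>
     applied_on T B \<rho> Ps)"

definition finished_tableaux :: "nat concept set \<Rightarrow> tableau set" where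
  "finished_tableaux S = {T. is_tableau S T \<and> finished T}"


section \<open>Soundness and constructive completeness\<close>

definition sound :: "'d itself \<Rightarrow> bool" where
  "sound \<tau> \<longleftrightarrow> (\<forall>S T. satisfiable \<tau> S \<and> T \<in> finished_tableaux S \<longrightarrow> \<not> closed_tableau T)"

text \<open>The root individual counts as occurring on every branch. This only matters for \<open>S = {}\<close>, where
  the root is empty and the model would otherwise have an empty domain.\<close>

definition branch_terms :: "tableau \<Rightarrow> nat list set \<Rightarrow> iterm set" where
  "branch_terms T B = insert (root_ind T) (terms (branch_fmls T B))"

text \<open>For \<open>t \<noteq> t'\<close> this is membership of \<open>t : {t'}\<close> in the branch. An individual may occur only inside a
  concept that is never decomposed on the branch; then \<open>t : {t}\<close> is absent, and the disjunct \<open>t = t'\<close>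
  gives it a class of its own.\<close>

definition branch_sim :: "tableau \<Rightarrow> nat list set \<Rightarrow> (iterm \<times> iterm) set" where
  "branch_sim T B = {(t, t'). t \<in> branch_terms T B \<and> t' \<in> branch_terms T B \<and>
     (t = t' \<or> At t (Nom t') \<in> branch_fmls T B)}"

definition constructively_complete :: bool where
  "constructively_complete \<longleftrightarrow>
     (\<forall>S T B. T \<in> finished_tableaux S \<and> open_branch T B \<longrightarrow>
        equiv (branch_terms T B) (branch_sim T B) \<and>
        (\<exists>I :: (iterm, iterm set) interp.
           term_model I \<and>
           domain I = branch_terms T B // branch_sim T B \<and>
           (\<forall>t\<in>branch_terms T B. ind I t = branch_sim T B `` {t}) \<and>
           (\<forall>t C. At t C \<in> branch_fmls T B \<longrightarrow> ind I t \<in> ext I C)))"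


section \<open>Termination\<close>

definition terminating :: "(nat concept set \<Rightarrow> tableau set) \<Rightarrow> bool" where
  "terminating \<D> \<longleftrightarrow> (\<forall>S T. finite S \<and> T \<in> \<D> S \<longrightarrow>
     (closed_tableau T \<longrightarrow> finite (nodes T)) \<and>
     (\<not> closed_tableau T \<longrightarrow> (\<exists>B. open_branch T B \<and> finite B)))"

definition introduction_order :: "tableau \<Rightarrow> nat list set \<Rightarrow> (iterm \<times> iterm) set \<Rightarrow> bool" where
  "introduction_order T B lt \<longleftrightarrow> strict_linear_order_on (terms (branch_fmls T B)) lt \<and>
     (\<forall>t\<in>terms (branch_fmls T B). \<forall>t'\<in>terms (branch_fmls T B).
        (\<exists>x\<in>B. t \<in> terms (formulas T x) \<and> t' \<notin> terms (formulas T x)) \<longrightarrow> (t, t') \<in> lt)"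

text \<open>Applications of the rule for \<open>\<exists>r.p\<close> are term-producing. So is an application of \<open>CongFn\<close> when
  \<open>f(r,p,l')\<close> does not occur in the given formulae \<open>L\<close>: if \<open>CongFn\<close> could introduce terms without
  restriction, then from \<open>l : {f(r,p,l)}\<close> it would generate infinitely many of them. No other rule
  introduces terms.\<close>

definition term_producing :: "fml set \<Rightarrow> rule_name \<Rightarrow> fml set list \<Rightarrow> bool" where
  "term_producing L \<rho> Xs \<longleftrightarrow> \<rho> = ExRule \<or> \<not> terms (\<Union> (set Xs)) \<subseteq> terms L"

text \<open>The terms a formula is about: its label and, in an equality \<open>t : {u}\<close> or a role link
  \<open>t : \<exists>r.{u}\<close>, also \<open>u\<close>. Individuals inside other concepts or inside an argument of \<open>f\<close> do not count.\<close>

fun main_terms :: "fml \<Rightarrow> iterm set" where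
  "main_terms (At t (Nom u)) = {t, u}"
| "main_terms (At t (Ex r (Nom u))) = {t, u}"
| "main_terms (At t C) = {t}"

definition blocked :: "(iterm \<times> iterm) set \<Rightarrow> fml set \<Rightarrow> fml list \<Rightarrow> bool" where
  "blocked lt L Ps \<longleftrightarrow> (\<exists>t t'. At t (Nom t') \<in> L \<and> (t, t') \<in> lt \<and> t' \<in> \<Union> (main_terms ` set Ps))"

definition c1 :: "(nat list set \<Rightarrow> (iterm \<times> iterm) set) \<Rightarrow> tableau \<Rightarrow> bool" where
  "c1 lt T \<longleftrightarrow> (\<forall>B x \<rho> Ps Xs. branch T B \<and> x \<in> B \<and> applied T x = Some (\<rho>, Ps) \<and> inst \<rho> Ps Xs \<and>
     term_producing (formulas T x) \<rho> Xs \<longrightarrow> \<not> blocked (lt B) (formulas T x) Ps)"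

text \<open>An application of \<open>UB\<close> to \<open>t\<close> and \<open>t'\<close> is possible as soon as both are labels, because
  \<open>t : {t}\<close> and \<open>t' : {t'}\<close> are then available through \<open>ReflLabel\<close>.\<close>

definition c2 :: "tableau \<Rightarrow> bool" where
  "c2 T \<longleftrightarrow> (\<forall>B. open_branch T B \<longrightarrow> (\<exists>x0\<in>B. \<forall>x\<in>B. \<forall>\<rho> Ps Xs.
     prefix x0 x \<and> applied T x = Some (\<rho>, Ps) \<and> inst \<rho> Ps Xs \<and> term_producing (formulas T x) \<rho> Xs \<longrightarrow>
     (\<forall>t\<in>label_terms (formulas T x). \<forall>t'\<in>label_terms (formulas T x).
        \<exists>y. strict_prefix y x \<and> applied T y = Some (UB, [At t (Nom t), At t' (Nom t')]))))"

text \<open>Everything applicable has been applied except what \<open>c1\<close> forbids.\<close>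

definition finished_c1 :: "(nat list set \<Rightarrow> (iterm \<times> iterm) set) \<Rightarrow> tableau \<Rightarrow> bool" where
  "finished_c1 lt T \<longleftrightarrow> (\<forall>B \<rho> Ps Xs. open_branch T B \<and> inst \<rho> Ps Xs \<and> set Ps \<subseteq> branch_fmls T B \<longrightarrow>
     applied_on T B \<rho> Ps \<or>
     (term_producing (branch_fmls T B) \<rho> Xs \<and> blocked (lt B) (branch_fmls T B) Ps))"

definition c1_c2_tableaux :: "nat concept set \<Rightarrow> tableau set" where
  "c1_c2_tableaux S = {T. is_tableau S T \<and>
     (\<exists>lt. (\<forall>B. branch T B \<longrightarrow> introduction_order T B (lt B)) \<and> c1 lt T \<and> finished_c1 lt T) \<and> c2 T}"

end

theory Submission
  imports Defs
begin

text \<open>Soundness: a model of the input, with \<open>f(r,C,t)\<close> interpreted as a chosen witness, makes the formulae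
  along some branch true, and a closure rule never applies to true formulae. Completeness: the
  formulae of an open branch form a Hintikka set, and equality of terms yields its canonical model.

  Termination: a closed tableau is finite by Koenig's lemma, since a closure node is a leaf. In an
  open tableau, the canonical model of an open branch is filtrated to a finite model, and then some
  branch is true in that finite model. There \<open>UB\<close> equates all labels with the same value, so that
  from some node onwards \<open>c1\<close> leaves only finitely many terms to which term-producing rules apply;
  hence this branch has finitely many terms, formulae and rule applications.\<close>

section \<open>Branches of tableaux\<close>

text \<open>The obstacle to termination is that an open branch may be infinite, since
  \<open>UB\<close> can keep choosing inequalities. The given open branch is therefore used only to
  show that the input is satisfiable; the finite branch is in general a different one, steered by a
  finite model that decides every disjunction. Even satisfiability takes care, because
  \<open>c1\<close> suppresses applications of \<open>ExRule\<close> and \<open>CongFn\<close> and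
  leaves the branch unsaturated. So \<open>hintikka\<close> demands closure only under the other
  rules, and yields a model for the language of SO alone; \<open>skolem_extension\<close> then
  assigns values to the terms \<open>f(r,C,t)\<close> anew, by choice. Only in the fully saturated
  case does \<open>CongFn\<close> make f well defined on classes, as constructive completeness
  requires.\<close>

lemma inst_functional: "inst \<rho> Ps Xs \<Longrightarrow> inst \<rho> Ps Xs' \<Longrightarrow> Xs = Xs'"
  by (erule inst.cases; auto elim: inst.cases)

lemma node_prefix:
  assumes T: "is_tableau S T" and "y \<in> nodes T" "prefix x y"
  shows "x \<in> nodes T"
proof -
  obtain zs where y: "y = x @ zs" using assms(3) by (auto simp: prefix_def)
  have "x @ zs \<in> nodes T \<Longrightarrow> x \<in> nodes T"
  proof (induction zs rule: rev_induct)
    case (snoc i zs)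
    then have "(x @ zs) @ [i] \<in> nodes T" by simp
    then have "x @ zs \<in> nodes T" using T unfolding is_tableau_def by blast
    then show ?case by (rule snoc.IH)
  qed simp
  then show ?thesis using assms(2) y by simp
qed

lemma node_applied:
  assumes "is_tableau S T" "x \<in> nodes T" "applied T x = Some (\<rho>, Ps)"
  obtains Xs where "expansion T x \<rho> Ps Xs"
  using assms unfolding is_tableau_def by fastforce

lemma node_child:
  assumes T: "is_tableau S T" and xi: "x @ [i] \<in> nodes T"
  obtains \<rho> Ps Xs where "x \<in> nodes T" "applied T x = Some (\<rho>, Ps)" "expansion T x \<rho> Ps Xs"
    "i < length Xs" "formulas T (x @ [i]) = formulas T x \<union> Xs ! i"
proof -
  have x: "x \<in> nodes T" using T xi unfolding is_tableau_def by blast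
  show thesis
  proof (cases "applied T x")
    case None
    then show ?thesis using T x xi unfolding is_tableau_def by fastforce
  next
    case (Some a)
    obtain \<rho> Ps where a: "a = (\<rho>, Ps)" by fastforce
    obtain Xs where e: "expansion T x \<rho> Ps Xs" using node_applied[OF T x] Some a by blast
    then have "i < length Xs" "formulas T (x @ [i]) = formulas T x \<union> Xs ! i"
      using xi unfolding expansion_def by auto
    then show ?thesis using that x Some a e by blast
  qed
qed

lemma node_induct [consumes 2, case_names root child]:
  assumes T: "is_tableau S T" and x: "x \<in> nodes T"
    and root: "P []"
    and child: "\<And>x i \<rho> Ps Xs. \<lbrakk>x \<in> nodes T; x @ [i] \<in> nodes T; P x; applied T x = Some (\<rho>, Ps);
      expansion T x \<rho> Ps Xs; i < length Xs; formulas T (x @ [i]) = formulas T x \<union> Xs ! i\<rbrakk>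
      \<Longrightarrow> P (x @ [i])"
  shows "P x"
  using x
proof (induction x rule: rev_induct)
  case Nil
  show ?case by (rule root)
next
  case (snoc i x)
  from node_child[OF T snoc.prems] show ?case
    by (metis child snoc.IH snoc.prems)
qed

lemma formulas_mono:
  assumes T: "is_tableau S T" and "prefix x y" "y \<in> nodes T"
  shows "formulas T x \<subseteq> formulas T y"
proof -
  have "prefix x y \<longrightarrow> formulas T x \<subseteq> formulas T y"
    using T assms(3)
  proof (induction y rule: node_induct)
    case (child y i \<rho> Ps Xs)
    then show ?case by (auto simp: prefix_snoc)
  qed simp
  then show ?thesis using assms(2) by blast
qed

lemma branch_nodes: "branch T B \<Longrightarrow> x \<in> B \<Longrightarrow> x \<in> nodes T"
  unfolding branch_def is_path_def by blast

lemma branch_comparable: "branch T B \<Longrightarrow> x \<in> B \<Longrightarrow> y \<in> B \<Longrightarrow> prefix x y \<or> prefix y x"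
  unfolding branch_def is_path_def by blast

lemma branch_insert:
  assumes "branch T B" "x \<in> nodes T" "\<And>y. y \<in> B \<Longrightarrow> prefix x y \<or> prefix y x"
  shows "x \<in> B"
proof -
  have "is_path T (insert x B)"
    using assms unfolding branch_def is_path_def by auto
  then show ?thesis using assms(1) unfolding branch_def by blast
qed

lemma branch_prefix:
  assumes T: "is_tableau S T" and B: "branch T B" and y: "y \<in> B" and xy: "prefix x y"
  shows "x \<in> B"
proof (rule branch_insert[OF B])
  show "x \<in> nodes T" using node_prefix[OF T _ xy] branch_nodes[OF B y] by blast
  fix z assume "z \<in> B"
  then show "prefix x z \<or> prefix z x"
    using branch_comparable[OF B y] xy prefix_same_cases prefix_order.trans by metis
qed

lemma branch_root: "is_tableau S T \<Longrightarrow> branch T B \<Longrightarrow> [] \<in> B"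
  by (rule branch_insert) (auto simp: is_tableau_def)

lemma strict_prefix_snocE:
  assumes "strict_prefix x y"
  obtains i where "prefix (x @ [i]) y"
  using assms by (auto elim!: strict_prefixE' simp: prefix_def)

text \<open>If \<open>B\<close> continues strictly below \<open>x\<close>, prefix closure puts a
  child of \<open>x\<close> on it. Otherwise \<open>x\<close> is the last node of \<open>B\<close>,
  child 0 is comparable with all of \<open>B\<close>, and maximality forces it in.\<close>

lemma branch_child:
  assumes T: "is_tableau S T" and B: "branch T B" and x: "x \<in> B"
    and ap: "applied T x = Some (\<rho>, Ps)" and inst: "inst \<rho> Ps Xs" and ne: "Xs \<noteq> []"
  obtains i where "i < length Xs" "x @ [i] \<in> B" "formulas T (x @ [i]) = formulas T x \<union> Xs ! i"
proof -
  have xn: "x \<in> nodes T" using branch_nodes[OF B x] .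
  obtain Xs' where e': "expansion T x \<rho> Ps Xs'" using node_applied[OF T xn ap] .
  then have "Xs' = Xs" using inst inst_functional unfolding expansion_def by blast
  then have e: "expansion T x \<rho> Ps Xs" using e' by simp
  have "\<exists>i. x @ [i] \<in> B"
  proof (cases "\<exists>y\<in>B. strict_prefix x y")
    case True
    then obtain y i where "y \<in> B" "prefix (x @ [i]) y" by (meson strict_prefix_snocE)
    then show ?thesis using branch_prefix[OF T B] by blast
  next
    case False
    have "x @ [0] \<in> B"
    proof (rule branch_insert[OF B])
      show "x @ [0] \<in> nodes T" using e ne unfolding expansion_def by simp
      fix y assume y: "y \<in> B"
      then have "prefix y x"
        using branch_comparable[OF B x y] False by (auto simp: strict_prefix_def)
      then show "prefix (x @ [0]) y \<or> prefix y (x @ [0])" by (simp add: prefix_snoc)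
    qed
    then show ?thesis by blast
  qed
  then obtain i where i: "x @ [i] \<in> B" by blast
  then have "i < length Xs" "formulas T (x @ [i]) = formulas T x \<union> Xs ! i"
    using e branch_nodes[OF B i] unfolding expansion_def by auto
  then show ?thesis using that i by blast
qed

lemma formulas_branch: "x \<in> B \<Longrightarrow> formulas T x \<subseteq> branch_fmls T B"
  unfolding branch_fmls_def by blast

text \<open>\<open>Closure\<close> is the only rule without conclusions and is never applied on an
  open branch, so the node of application has a child on the branch.\<close>

lemma applied_on_conclusion:
  assumes T: "is_tableau S T" and B: "open_branch T B" and ap: "applied_on T B \<rho> Ps"
    and inst: "inst \<rho> Ps Xs"
  shows "\<exists>X\<in>set Xs. X \<subseteq> branch_fmls T B"
proof -
  have b: "branch T B" using B unfolding open_branch_def by blast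
  obtain x where x: "x \<in> B" "applied T x = Some (\<rho>, Ps)" using ap unfolding applied_on_def by blast
  have ne: "Xs \<noteq> []"
  proof
    assume "Xs = []"
    then have "\<rho> = Closure" using inst by (auto elim: inst.cases)
    then show False using B ap unfolding open_branch_def closed_branch_def by blast
  qed
  obtain i where "i < length Xs" "x @ [i] \<in> B" "formulas T (x @ [i]) = formulas T x \<union> Xs ! i"
    using branch_child[OF T b x inst ne] .
  then show ?thesis using formulas_branch[of "x @ [i]" B T] nth_mem by (metis Un_subset_iff)
qed

section \<open>Existence of branches and Koenig's lemma\<close>

text \<open>Dependent choice. It serves twice: with "infinitely many nodes below" as
  \<open>P\<close> for Koenig's lemma, and with "all formulae true in a model" as \<open>P\<close>
  for soundness.\<close>

lemma branch_exists:
  assumes T: "is_tableau S T" and root: "P []"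
    and step: "\<And>x i. x \<in> nodes T \<Longrightarrow> P x \<Longrightarrow> x @ [i] \<in> nodes T \<Longrightarrow> \<exists>j. x @ [j] \<in> nodes T \<and> P (x @ [j])"
  obtains B where "branch T B" "\<And>x. x \<in> B \<Longrightarrow> P x"
proof -
  \<comment> \<open>At a leaf the node stays put, so a finite branch appears as an eventually
    constant sequence.\<close>
  define next_node where "next_node x =
    (if \<exists>i. x @ [i] \<in> nodes T then x @ [SOME j. x @ [j] \<in> nodes T \<and> P (x @ [j])] else x)" for x
  define path where "path n = (next_node ^^ n) []" for n
  have path0: "path 0 = []" and path_Suc: "path (Suc n) = next_node (path n)" for n
    by (simp_all add: path_def)
  have next_ok: "next_node x \<in> nodes T \<and> P (next_node x)" if "x \<in> nodes T" "P x" for x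
  proof (cases "\<exists>i. x @ [i] \<in> nodes T")
    case True
    then have "\<exists>j. x @ [j] \<in> nodes T \<and> P (x @ [j])" using step that by blast
    then show ?thesis using True someI_ex[of "\<lambda>j. x @ [j] \<in> nodes T \<and> P (x @ [j])"]
      by (simp add: next_node_def)
  qed (use that in \<open>auto simp: next_node_def\<close>)
  have ok: "path n \<in> nodes T \<and> P (path n)" for n
  proof (induction n)
    case 0
    then show ?case using T root by (simp add: path0 is_tableau_def)
  qed (use next_ok in \<open>auto simp: path_Suc\<close>)
  have mono: "prefix (path n) (path (n + m))" for n m
  proof (induction m)
    case (Suc m)
    have "prefix x (next_node x)" for x by (simp add: next_node_def)
    then show ?case using Suc prefix_order.trans by (auto simp: path_Suc)
  qed simp
  have chain: "prefix (path m) (path n) \<or> prefix (path n) (path m)" for m n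
    using mono le_Suc_ex nat_le_linear by metis
  have "is_path T (range path)" using ok chain unfolding is_path_def by auto
  moreover have "B' = range path" if B': "is_path T B'" "range path \<subseteq> B'" for B'
  proof -
    have "z \<in> range path" if z: "z \<in> B'" for z
    proof -
      have zn: "z \<in> nodes T" using z B' unfolding is_path_def by blast
      have inner: "\<exists>j. path (Suc n) = path n @ [j]" if sp: "strict_prefix (path n) z" for n
      proof -
        obtain i where "prefix (path n @ [i]) z" using strict_prefix_snocE[OF sp] by blast
        then have "path n @ [i] \<in> nodes T" using node_prefix[OF T zn] by blast
        then show ?thesis by (auto simp: path_Suc next_node_def)
      qed
      \<comment> \<open>Otherwise the path would grow by one at every step, and
        \<open>path (length z)\<close> would be as long as \<open>z\<close>.\<close>
      have "\<exists>n. \<not> strict_prefix (path n) z"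
      proof (rule ccontr)
        assume "\<nexists>n. \<not> strict_prefix (path n) z"
        then have all: "strict_prefix (path n) z" for n by blast
        have "length (path n) = n" for n
        proof (induction n)
          case (Suc n)
          then show ?case using inner[OF all[of n]] by auto
        qed (simp add: path0)
        then show False using all[of "length z"] prefix_length_less by fastforce
      qed
      then obtain n where n: "\<not> strict_prefix (path n) z" and
        least: "\<And>m. m < n \<Longrightarrow> strict_prefix (path m) z"
        using exists_least_iff[of "\<lambda>n. \<not> strict_prefix (path n) z"] by blast
      have "path n \<in> B'" using B' by blast
      then have zp: "prefix z (path n)"
        using n B'(1) z unfolding is_path_def by (auto simp: strict_prefix_def)
      show ?thesis
      proof (cases n)
        case 0
        then show ?thesis using zp path0 by (metis prefix_Nil rangeI)
      next
        case (Suc m)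
        then have sp: "strict_prefix (path m) z" using least by simp
        then obtain j where "path n = path m @ [j]" using inner Suc by blast
        then have "z = path n" using zp sp by (auto simp: prefix_snoc strict_prefix_def)
        then show ?thesis by blast
      qed
    qed
    then show ?thesis using B'(2) by blast
  qed
  ultimately have "branch T (range path)" unfolding branch_def by blast
  then show ?thesis using that ok by blast
qed

lemma closed_tableau_finite:
  assumes T: "is_tableau S T" and closed: "closed_tableau T"
  shows "finite (nodes T)"
proof (rule ccontr)
  let ?below = "\<lambda>x. {y \<in> nodes T. prefix x y}"
  assume inf: "infinite (nodes T)"
  have step: "\<exists>j. x @ [j] \<in> nodes T \<and> infinite (?below (x @ [j]))"
    if x: "x \<in> nodes T" "infinite (?below x)" and xi: "x @ [i] \<in> nodes T" for x i
  proof (rule ccontr)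
    assume no: "\<nexists>j. x @ [j] \<in> nodes T \<and> infinite (?below (x @ [j]))"
    obtain \<rho> Ps Xs where e: "expansion T x \<rho> Ps Xs" using node_child[OF T xi] .
    have "?below x \<subseteq> insert x (\<Union>i<length Xs. ?below (x @ [i]))"
    proof
      fix y assume y: "y \<in> ?below x"
      show "y \<in> insert x (\<Union>i<length Xs. ?below (x @ [i]))"
      proof (cases "y = x")
        case False
        then have "strict_prefix x y" using y by (auto simp: strict_prefix_def)
        then obtain i where i: "prefix (x @ [i]) y" by (blast elim: strict_prefix_snocE)
        then have "x @ [i] \<in> nodes T" using node_prefix[OF T] y by blast
        then have "i < length Xs" using e unfolding expansion_def by blast
        then show ?thesis using i y by blast
      qed simp
    qed
    moreover have fin: "finite (?below (x @ [i]))" if "i < length Xs" for i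
      using no e that unfolding expansion_def by blast
    then have "finite (insert x (\<Union>i<length Xs. ?below (x @ [i])))"
      by (intro finite.insertI finite_UN_I) auto
    ultimately have "finite (?below x)" by (rule finite_subset)
    then show False using x by blast
  qed
  define P where "P x = infinite (?below x)" for x
  have "P []" using inf by (simp add: P_def)
  then obtain B where B: "branch T B" and inf_B: "\<And>x. x \<in> B \<Longrightarrow> P x"
    using branch_exists[OF T, of P] step unfolding P_def[symmetric] by metis
  obtain x Ps where x: "x \<in> B" "applied T x = Some (Closure, Ps)"
    using closed B unfolding closed_tableau_def closed_branch_def applied_on_def by blast
  have xn: "x \<in> nodes T" using branch_nodes[OF B x(1)] .
  obtain Xs where "expansion T x Closure Ps Xs" using node_applied[OF T xn x(2)] .
  then have leaf: "x @ [i] \<notin> nodes T" for i unfolding expansion_def by (auto elim: inst.cases)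
  have "?below x \<subseteq> {x}"
  proof
    fix y assume y: "y \<in> ?below x"
    show "y \<in> {x}"
    proof (rule ccontr)
      assume "y \<notin> {x}"
      then have "strict_prefix x y" using y by (auto simp: strict_prefix_def)
      then obtain i where i: "prefix (x @ [i]) y" by (blast elim: strict_prefix_snocE)
      then show False using node_prefix[OF T _ i] y leaf by blast
    qed
  qed
  then show False using inf_B[OF x(1)] finite_subset unfolding P_def by blast
qed


section \<open>Models\<close>

text \<open>Agreement is asked only on individuals occurring in \<open>C\<close>; this is what
  permits a fresh root individual to be reinterpreted.\<close>

lemma ext_map_concept:
  assumes "domain J = domain I" "con J = con I" "rol J = rol I"
    and "\<And>i. i \<in> set_concept C \<Longrightarrow> ind J (f i) = ind I i"
  shows "ext J (map_concept f C) = ext I C"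
  using assms by (induction C) auto

primrec holds :: "(iterm, 'd) interp \<Rightarrow> fml \<Rightarrow> bool" where
  "holds J (At t C) \<longleftrightarrow> ind J t \<in> ext J C"

definition skolem_model :: "(iterm, 'd) interp \<Rightarrow> bool" where
  "skolem_model J \<longleftrightarrow> term_model J \<and> (\<forall>r C t y. (ind J t, y) \<in> rol J r \<and> y \<in> ext J C \<longrightarrow>
     (ind J t, ind J (Fn r C t)) \<in> rol J r \<and> ind J (Fn r C t) \<in> ext J C)"

text \<open>Beyond unfolding the semantics, \<open>ExRule\<close> uses the witness property,
  \<open>NegEx\<close> that the successor lies in the domain (negation is relative to it),
  \<open>TransRule\<close> transitivity, and \<open>CongFn\<close> the congruence of f.\<close>

lemma inst_sound:
  assumes J: "skolem_model J" and "inst \<rho> Ps Xs" and "\<forall>F\<in>set Ps. holds J F"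
  shows "\<exists>X\<in>set Xs. \<forall>F\<in>X. holds J F"
proof -
  have m: "so_model J" and sk: "(ind J t, y) \<in> rol J r \<Longrightarrow> y \<in> ext J C \<Longrightarrow>
     (ind J t, ind J (Fn r C t)) \<in> rol J r \<and> ind J (Fn r C t) \<in> ext J C"
    and cong: "ind J t = ind J t' \<Longrightarrow> ind J (Fn r C t) = ind J (Fn r C t')" for r C t t' y
    using J unfolding skolem_model_def term_model_def by blast+
  have dom: "ind J t \<in> domain J" and rol: "(d, e) \<in> rol J r \<Longrightarrow> e \<in> domain J"
    and tr: "trans (rol J r)" for t d e r
    using m unfolding so_model_def by auto
  show ?thesis
    using assms(2,3)
  proof cases
    case (4 l r p)
    then show ?thesis using assms(3) sk by fastforce
  next
    case (5 l r p l')
    then show ?thesis using assms(3) dom by auto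
  next
    case (6 l r l' l'')
    then show ?thesis using assms(3) tr[of r] by (auto dest: transD)
  next
    case (13 r p l l')
    then show ?thesis using assms(3) cong[of l l' r p] by auto
  qed (use assms(3) dom in auto)
qed

text \<open>Individuals are evaluated first, so that \<open>f(r,C,t)\<close> can be chosen as a function of the values
  of \<open>C\<close> and \<open>t\<close> alone; a concept over the domain names its elements by themselves.\<close>

primrec skolem_ind :: "(nat, 'd) interp \<Rightarrow> 'd \<Rightarrow> iterm \<Rightarrow> 'd" where
  "skolem_ind I e (Ind n) = ind I n"
| "skolem_ind I e New = e"
| "skolem_ind I e (Fn r C t) =
    (let A = {y. (skolem_ind I e t, y) \<in> rol I r \<and>
        y \<in> ext \<lparr>domain = domain I, ind = id, con = con I, rol = rol I\<rparr> (map_concept (skolem_ind I e) C)}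
     in if A = {} then e else (SOME y. y \<in> A))"

lemma skolem_extension:
  fixes I :: "(nat, 'd) interp"
  assumes I: "so_model I" and x: "x \<in> domain I" and S: "\<forall>C\<in>S. x \<in> ext I C" and a: "fresh S a"
  obtains J :: "(iterm, 'd) interp" where "skolem_model J" "domain J = domain I"
    "\<forall>C\<in>S. holds J (At a (map_concept Ind C))"
proof -
  \<comment> \<open>The root individual must denote \<open>x\<close>. A root \<open>Ind n\<close> is
    redirected, harmlessly since \<open>n\<close> does not occur in \<open>S\<close>; a root
    \<open>New\<close> receives the default value, which is chosen to be \<open>x\<close>.\<close>
  define I' where "I' = (case a of Ind n \<Rightarrow> I\<lparr>ind := (ind I)(n := x)\<rparr> | _ \<Rightarrow> I)"
  define J where "J = \<lparr>domain = domain I', ind = skolem_ind I' x, con = con I', rol = rol I'\<rparr>"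
  have I'_simps: "domain I' = domain I" "con I' = con I" "rol I' = rol I"
    by (auto simp: I'_def split: iterm.split)
  have I': "so_model I'"
    using I x by (auto simp: so_model_def I'_def split: iterm.split)
  \<comment> \<open>Identifies the extension used inside \<open>skolem_ind\<close> with the one in
    \<open>J\<close>, so that \<open>ind_Fn\<close> can speak of \<open>J\<close> alone.\<close>
  have ext: "ext J C = ext \<lparr>domain = domain I', ind = id, con = con I', rol = rol I'\<rparr>
    (map_concept (skolem_ind I' x) C)" for C
    by (rule ext_map_concept[symmetric]) (simp_all add: J_def)
  have ind_Fn: "ind J (Fn r C t) =
    (let A = {y. (ind J t, y) \<in> rol J r \<and> y \<in> ext J C} in if A = {} then x else (SOME y. y \<in> A))"
    for r C t unfolding ext by (simp add: J_def)
  have wit: "(ind J t, ind J (Fn r C t)) \<in> rol J r \<and> ind J (Fn r C t) \<in> ext J C"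
    if "(ind J t, y) \<in> rol J r" "y \<in> ext J C" for r C t y
  proof -
    define A where "A = {y. (ind J t, y) \<in> rol J r \<and> y \<in> ext J C}"
    have ne: "A \<noteq> {}" using that by (auto simp: A_def)
    have "ind J (Fn r C t) = (if A = {} then x else (SOME y. y \<in> A))"
      unfolding A_def ind_Fn by (simp only: Let_def)
    then have "ind J (Fn r C t) \<in> A" using ne by (simp add: some_in_eq)
    then show ?thesis by (simp add: A_def)
  qed
  have dom: "ind J t \<in> domain J" for t
  proof (cases t)
    case (Fn r C t')
    define A where "A = {y. (ind J t', y) \<in> rol J r \<and> y \<in> ext J C}"
    have "ind J t = (if A = {} then x else (SOME y. y \<in> A))"
      unfolding A_def Fn ind_Fn by (simp only: Let_def)
    moreover have "A \<subseteq> domain J" using I' unfolding A_def J_def so_model_def by fastforce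
    moreover have "x \<in> domain J" using x by (simp add: J_def I'_simps)
    ultimately show ?thesis by (metis some_in_eq subsetD)
  qed (use I' x in \<open>auto simp: J_def so_model_def I'_simps\<close>)
  have "so_model J" using I' dom by (auto simp: so_model_def J_def)
  moreover have "ind J (Fn r C t) = ind J (Fn r C t')" if "ind J t = ind J t'" for r C t t'
    using that by (simp add: J_def)
  ultimately have "skolem_model J" using wit unfolding skolem_model_def term_model_def by blast
  moreover have "holds J (At a (map_concept Ind C))" if C: "C \<in> S" for C
  proof -
    have "ext J (map_concept Ind C) = ext I C"
      using a C by (intro ext_map_concept) (auto simp: J_def I'_simps I'_def fresh_def)
    moreover have "ind J a = x" using a by (auto simp: J_def I'_def fresh_def)
    ultimately show ?thesis using S C by simp
  qed
  ultimately show ?thesis using that by (simp add: J_def I'_simps)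
qed

lemma true_branch:
  assumes T: "is_tableau S T" and J: "skolem_model J"
    and root: "\<forall>C\<in>S. holds J (At (root_ind T) (map_concept Ind C))"
  obtains B where "open_branch T B" "\<And>F. F \<in> branch_fmls T B \<Longrightarrow> holds J F"
proof -
  define P where "P x \<longleftrightarrow> (\<forall>F\<in>formulas T x. holds J F)" for x
  have r: "P []" using T root by (auto simp: is_tableau_def P_def)
  have step: "\<exists>j. x @ [j] \<in> nodes T \<and> P (x @ [j])"
    if x: "x \<in> nodes T" "P x" and xi: "x @ [i] \<in> nodes T" for x i
  proof -
    obtain \<rho> Ps Xs where e: "expansion T x \<rho> Ps Xs" using node_child[OF T xi] .
    then have inst: "inst \<rho> Ps Xs" and Ps: "\<forall>F\<in>set Ps. holds J F"
      using x by (auto simp: expansion_def P_def)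
    obtain X where "X \<in> set Xs" "\<forall>F\<in>X. holds J F" using inst_sound[OF J inst Ps] by blast
    then obtain j where "j < length Xs" "\<forall>F\<in>Xs ! j. holds J F" by (metis in_set_conv_nth)
    then show ?thesis using e x unfolding expansion_def P_def by (intro exI[of _ j]) auto
  qed
  obtain B where B: "branch T B" and true: "\<And>x. x \<in> B \<Longrightarrow> P x"
    using branch_exists[OF T, of P] r step by blast
  have all: "holds J F" if "F \<in> branch_fmls T B" for F
    using that true by (auto simp: branch_fmls_def P_def)
  have "\<not> closed_branch T B"
  proof
    assume "closed_branch T B"
    then obtain x Ps where x: "x \<in> B" "applied T x = Some (Closure, Ps)"
      unfolding closed_branch_def applied_on_def by blast
    obtain Xs where "expansion T x Closure Ps Xs"
      using node_applied[OF T branch_nodes[OF B x(1)] x(2)] .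
    then have "inst Closure Ps Xs" "\<forall>F\<in>set Ps. holds J F"
      using true[OF x(1)] by (auto simp: expansion_def P_def)
    then show False by (auto elim!: inst.cases)
  qed
  then show ?thesis using that B all unfolding open_branch_def by blast
qed

lemma soundness: "sound TYPE('d)"
  unfolding sound_def
proof (intro allI impI)
  fix S T assume "satisfiable TYPE('d) S \<and> T \<in> finished_tableaux S"
  then obtain I :: "(nat, 'd) interp" and x where I: "so_model I" "x \<in> domain I" "\<forall>C\<in>S. x \<in> ext I C"
    and T: "is_tableau S T"
    unfolding satisfiable_def finished_tableaux_def by blast
  have "fresh S (root_ind T)" using T unfolding is_tableau_def by blast
  then obtain J :: "(iterm, 'd) interp" where "skolem_model J"
    "\<forall>C\<in>S. holds J (At (root_ind T) (map_concept Ind C))"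
    using skolem_extension[OF I] by blast
  then obtain B where "open_branch T B" using true_branch[OF T] by blast
  then show "\<not> closed_tableau T" unfolding closed_tableau_def open_branch_def by blast
qed

section \<open>Finite models by filtration\<close>

primrec subconcepts :: "'i concept \<Rightarrow> 'i concept set" where
  "subconcepts (Con p) = {Con p}"
| "subconcepts (Nom i) = {Nom i}"
| "subconcepts (Neg C) = insert (Neg C) (subconcepts C)"
| "subconcepts (Or C D) = insert (Or C D) (subconcepts C \<union> subconcepts D)"
| "subconcepts (Ex r C) = insert (Ex r C) (subconcepts C)"

lemma subconcepts_refl: "C \<in> subconcepts C"
  by (cases C) auto

lemma subconcepts_trans: "D \<in> subconcepts C \<Longrightarrow> subconcepts D \<subseteq> subconcepts C"
  by (induction C) auto

lemma finite_subconcepts: "finite (subconcepts C)"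
  by (induction C) auto

text \<open>The transitive (Lemmon) filtration through the subconcepts of \<open>S\<close>.\<close>

lemma finite_model:
  fixes I :: "('i, 'd) interp"
  assumes I: "so_model I" and x: "x \<in> domain I" and S: "\<forall>C\<in>S. x \<in> ext I C" and fin: "finite S"
  obtains J :: "('i, 'i concept set) interp" and y where "so_model J" "finite (domain J)"
    "y \<in> domain J" "\<forall>C\<in>S. y \<in> ext J C"
proof -
  define \<Sigma> where "\<Sigma> = \<Union> (subconcepts ` S)"
  define ty where "ty d = {C \<in> \<Sigma>. d \<in> ext I C}" for d
  \<comment> \<open>Asking for \<open>Ex r C\<close> in \<open>X\<close> also when merely
    \<open>Ex r C\<close> is in \<open>Y\<close> makes the relation transitive by definition. It
    still contains the image of every original edge, because the original role is
    transitive.\<close>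
  define J where "J = \<lparr>domain = ty ` domain I, ind = ty \<circ> ind I,
    con = (\<lambda>p. {X \<in> ty ` domain I. Con p \<in> X}),
    rol = (\<lambda>r. {(X, Y). X \<in> ty ` domain I \<and> Y \<in> ty ` domain I \<and>
      (\<forall>C. Ex r C \<in> \<Sigma> \<and> (C \<in> Y \<or> Ex r C \<in> Y) \<longrightarrow> Ex r C \<in> X)})\<rparr>"
  have \<Sigma>: "subconcepts C \<subseteq> \<Sigma>" if "C \<in> \<Sigma>" for C
    using that subconcepts_trans unfolding \<Sigma>_def by blast
  have dom: "ind I i \<in> domain I" and rol: "rol I r \<subseteq> domain I \<times> domain I" and tr: "trans (rol I r)"
    for i r using I unfolding so_model_def by auto
  have "trans (rol J r)" for r by (rule transI) (auto simp: J_def)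
  moreover have "rol J r \<subseteq> domain J \<times> domain J" for r by (auto simp: J_def)
  moreover have "con J p \<subseteq> domain J" for p by (auto simp: J_def)
  moreover have "ind J i \<in> domain J" "domain J \<noteq> {}" for i using dom by (auto simp: J_def)
  ultimately have model: "so_model J" unfolding so_model_def by blast
  have truth: "ty d \<in> ext J C \<longleftrightarrow> d \<in> ext I C" if "C \<in> \<Sigma>" "d \<in> domain I" for C d
    using that
  proof (induction C arbitrary: d)
    case (Con p)
    then show ?case by (auto simp: J_def ty_def)
  next
    case (Nom i)
    \<comment> \<open>Nominals survive the quotient: a type containing \<open>Nom i\<close> belongs
      to the named element only.\<close>
    have "ty d = ty (ind I i) \<longleftrightarrow> d = ind I i"
    proof
      assume "ty d = ty (ind I i)"
      then have "Nom i \<in> ty d" using Nom by (auto simp: ty_def)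
      then show "d = ind I i" by (simp add: ty_def)
    qed simp
    then show ?case by (simp add: J_def)
  next
    case (Neg C)
    have "C \<in> \<Sigma>" using \<Sigma>[OF Neg.prems(1)] by (auto simp: subconcepts_refl)
    then show ?case using Neg by (auto simp: J_def)
  next
    case (Or C D)
    have "C \<in> \<Sigma>" "D \<in> \<Sigma>" using \<Sigma>[OF Or.prems(1)] by (auto simp: subconcepts_refl)
    then show ?case using Or by auto
  next
    case (Ex r C)
    have C: "C \<in> \<Sigma>" using \<Sigma>[OF Ex.prems(1)] by (auto simp: subconcepts_refl)
    show ?case
    proof
      assume "ty d \<in> ext J (Ex r C)"
      then obtain e where e: "e \<in> domain I" "(ty d, ty e) \<in> rol J r" "ty e \<in> ext J C"
        by (auto simp: J_def)
      then have "C \<in> ty e" using Ex.IH[OF C] C by (simp add: ty_def)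
      then have "Ex r C \<in> ty d" using e(2) Ex.prems(1) by (auto simp: J_def)
      then show "d \<in> ext I (Ex r C)" by (simp add: ty_def)
    next
      assume "d \<in> ext I (Ex r C)"
      then obtain e where e: "(d, e) \<in> rol I r" "e \<in> ext I C" by auto
      have ed: "e \<in> domain I" using e rol by blast
      have "Ex r D \<in> ty d" if D: "Ex r D \<in> \<Sigma>" and "D \<in> ty e \<or> Ex r D \<in> ty e" for D
      proof -
        have "\<exists>z. (d, z) \<in> rol I r \<and> z \<in> ext I D"
          using that(2) e(1) transD[OF tr[of r]] by (auto simp: ty_def)
        then show ?thesis using D by (simp add: ty_def)
      qed
      then have "(ty d, ty e) \<in> rol J r" using ed Ex.prems(2) by (auto simp: J_def)
      moreover have "ty e \<in> ext J C" using Ex.IH[OF C ed] e by blast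
      ultimately show "ty d \<in> ext J (Ex r C)" by auto
    qed
  qed
  have "finite \<Sigma>" using fin by (auto simp: \<Sigma>_def finite_subconcepts)
  moreover have "domain J \<subseteq> Pow \<Sigma>" by (auto simp: J_def ty_def)
  ultimately have "finite (domain J)" by (metis finite_Pow_iff finite_subset)
  moreover have "ty x \<in> domain J" using x by (simp add: J_def)
  moreover have "\<forall>C\<in>S. ty x \<in> ext J C"
    using truth[OF _ x] S subconcepts_refl unfolding \<Sigma>_def by blast
  ultimately show ?thesis using that model by blast
qed


section \<open>Terms occurring in a tableau\<close>

lemma subterms_refl: "t \<in> subterms t"
  by (cases t) auto

lemma subterms_trans: "u \<in> subterms t \<Longrightarrow> subterms u \<subseteq> subterms t"
proof (induction t)
  case (Fn r C t)
  then show ?case by (fastforce simp: concept.set_map)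
qed auto

lemma subterms_terms: "u \<in> terms L \<Longrightarrow> subterms u \<subseteq> terms L"
proof -
  assume "u \<in> terms L"
  then obtain F where F: "F \<in> L" "u \<in> fml_terms F" unfolding terms_def by blast
  then have "subterms u \<subseteq> fml_terms F" using subterms_trans by (cases F) fastforce
  then show ?thesis using F unfolding terms_def by blast
qed

lemma terms_At: "At t C \<in> L \<Longrightarrow> t \<in> terms L"
  and terms_set_concept: "At t C \<in> L \<Longrightarrow> u \<in> set_concept C \<Longrightarrow> u \<in> terms L"
  using subterms_refl by (force simp: terms_def)+

lemma terms_mono: "L \<subseteq> L' \<Longrightarrow> terms L \<subseteq> terms L'"
  unfolding terms_def by blast

lemma terms_Un: "terms (L \<union> L') = terms L \<union> terms L'"
  unfolding terms_def by blast

lemma terms_branch_fmls: "terms (branch_fmls T B) = (\<Union>x\<in>B. terms (formulas T x))"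
  unfolding terms_def branch_fmls_def by blast

text \<open>All other rules merely rearrange terms of their premises. Even these two add just one
  term, since its arguments and their subterms already occur in the premises.\<close>

lemma new_term_cases:
  assumes inst: "inst \<rho> Ps Xs" and Ps: "set Ps \<subseteq> L" and X: "X \<in> set Xs"
    and u: "u \<in> terms X" "u \<notin> terms L"
  obtains (ExRule) l r p where "\<rho> = ExRule" "Ps = [At l (Ex r p)]" "u = Fn r p l"
      "X = {At l (Ex r (Nom (Fn r p l))), At (Fn r p l) p}"
  | (CongFn) l l' r p where "\<rho> = CongFn" "Ps = [At (Fn r p l) (Nom (Fn r p l)), At l (Nom l')]"
      "u = Fn r p l'" "X = {At (Fn r p l) (Nom (Fn r p l'))}"
proof -
  have old: "u \<notin> terms (set Ps)" using u(2) terms_mono[OF Ps] by blast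
  show thesis
    using inst
  proof cases
    case (4 l r p)
    have "u = Fn r p l"
      using u(1) X old unfolding 4 by (auto simp: terms_def concept.set_map)
    then show ?thesis using ExRule X 4 by simp
  next
    case (13 r p l l')
    have "u = Fn r p l'"
      using u(1) X old unfolding 13 by (auto simp: terms_def concept.set_map)
    then show ?thesis using CongFn X 13 by simp
  qed (use u(1) X old in \<open>auto simp: terms_def\<close>)
qed

text \<open>A term introduced by \<open>CongFn\<close> need not be a label at once, but then it is equated to an older term.\<close>

lemma introduced_term:
  assumes T: "is_tableau S T" and "x \<in> nodes T" and "u \<in> terms (formulas T x)"
  shows "u \<in> terms (formulas T []) \<or>
    (\<exists>y i. prefix (y @ [i]) x \<and> u \<notin> terms (formulas T y) \<and>
      (u \<in> label_terms (formulas T x) \<or> (\<exists>v\<in>terms (formulas T y). At v (Nom u) \<in> formulas T x)))"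
  using assms
proof (induction x rule: node_induct)
  case (child x i \<rho> Ps Xs)
  have sub: "formulas T x \<subseteq> formulas T (x @ [i])" using child.hyps by blast
  show ?case
  proof (cases "u \<in> terms (formulas T x)")
    case True
    then consider "u \<in> terms (formulas T [])"
      | y j where "prefix (y @ [j]) x" "u \<notin> terms (formulas T y)"
        "u \<in> label_terms (formulas T x) \<or> (\<exists>v\<in>terms (formulas T y). At v (Nom u) \<in> formulas T x)"
      using child.IH by blast
    then show ?thesis
    proof cases
      case (2 y j)
      then have "prefix (y @ [j]) (x @ [i])" by (simp add: prefix_snoc)
      moreover have "u \<in> label_terms (formulas T (x @ [i])) \<or>
          (\<exists>v\<in>terms (formulas T y). At v (Nom u) \<in> formulas T (x @ [i]))"
        using 2(3) sub unfolding label_terms_def by blast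
      ultimately show ?thesis using 2(2) by blast
    qed simp
  next
    case False
    have inst: "inst \<rho> Ps Xs" "set Ps \<subseteq> formulas T x"
      using child.hyps unfolding expansion_def by auto
    have X: "Xs ! i \<in> set Xs" using child.hyps by simp
    have u: "u \<in> terms (Xs ! i)" using child.prems child.hyps False by (auto simp: terms_Un)
    have "u \<in> label_terms (formulas T (x @ [i])) \<or>
        (\<exists>v\<in>terms (formulas T x). At v (Nom u) \<in> formulas T (x @ [i]))"
      using inst X u False
    proof (cases rule: new_term_cases)
      case (ExRule l r p)
      then show ?thesis using child.hyps by (auto simp: label_terms_def)
    next
      case (CongFn l l' r p)
      then have "Fn r p l \<in> terms (formulas T x)" using inst by (auto intro: terms_At)
      moreover have "At (Fn r p l) (Nom u) \<in> formulas T (x @ [i])" using CongFn child.hyps by auto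
      ultimately show ?thesis by blast
    qed
    then show ?thesis using False by blast
  qed
qed simp

text \<open>Hence every f-term on a branch was introduced by a rule, and the second alternative of
  \<open>introduced_term\<close> applies to it.\<close>

lemma root_terms:
  assumes T: "is_tableau S T"
  shows "Fn r C t \<notin> terms (formulas T [])" "Fn r C t \<noteq> root_ind T"
  using T by (auto simp: is_tableau_def terms_def fresh_def concept.set_map)


section \<open>Hintikka sets and their canonical models\<close>

definition rule_closed :: "fml set \<Rightarrow> rule_name \<Rightarrow> bool" where
  "rule_closed L \<rho> \<longleftrightarrow> (\<forall>Ps Xs. inst \<rho> Ps Xs \<and> set Ps \<subseteq> L \<longrightarrow> (\<exists>X\<in>set Xs. X \<subseteq> L))"

lemma rule_closedD: "rule_closed L \<rho> \<Longrightarrow> inst \<rho> Ps Xs \<Longrightarrow> set Ps \<subseteq> L \<Longrightarrow> \<exists>X\<in>set Xs. X \<subseteq> L"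
  unfolding rule_closed_def by blast

text \<open>The witness may be found at an equal term \<open>m\<close>, because \<open>c1\<close> blocks the rule for \<open>\<exists>r.p\<close> at all but
  the least term of a class, and none is needed for \<open>\<exists>r.{u}\<close>, where even that term can be blocked
  through \<open>u\<close>.\<close>

locale hintikka =
  fixes L :: "fml set" and a :: iterm
  assumes closed: "\<rho> \<notin> {ExRule, CongFn} \<Longrightarrow> rule_closed L \<rho>"
    and witness: "At l (Ex r p) \<in> L \<Longrightarrow> \<exists>m u. (m = l \<or> At m (Nom l) \<in> L) \<and> At m (Ex r (Nom u)) \<in> L \<and>
      (p = Nom u \<or> At u p \<in> L)"
begin

lemma closedD: "inst \<rho> Ps Xs \<Longrightarrow> \<rho> \<notin> {ExRule, CongFn} \<Longrightarrow> set Ps \<subseteq> L \<Longrightarrow> \<exists>X\<in>set Xs. X \<subseteq> L"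
  by (rule rule_closedD[OF closed])

lemma neg_neg: "At l (Neg (Neg p)) \<in> L \<Longrightarrow> At l p \<in> L"
  using closedD[OF inst.intros(1)[of l p]] by auto

lemma or_cases: "At l (Or p q) \<in> L \<Longrightarrow> At l p \<in> L \<or> At l q \<in> L"
  using closedD[OF inst.intros(2)[of l p q]] by auto

lemma neg_or: "At l (Neg (Or p q)) \<in> L \<Longrightarrow> At l (Neg p) \<in> L \<and> At l (Neg q) \<in> L"
  using closedD[OF inst.intros(3)[of l p q]] by auto

lemma neg_ex: "At l (Neg (Ex r p)) \<in> L \<Longrightarrow> At l (Ex r (Nom l')) \<in> L \<Longrightarrow> At l' (Neg p) \<in> L"
  using closedD[OF inst.intros(5)[of l r p l']] by auto

lemma link_trans: "At l (Ex r (Nom l')) \<in> L \<Longrightarrow> At l' (Ex r (Nom l'')) \<in> L \<Longrightarrow> At l (Ex r (Nom l'')) \<in> L"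
  using closedD[OF inst.intros(6)[of l r l' l'']] by auto

lemma nom_sym: "At l (Nom l') \<in> L \<Longrightarrow> At l' (Nom l) \<in> L"
  using closedD[OF inst.intros(7)[of l l']] by auto

lemma neg_nom: "At l (Neg (Nom l')) \<in> L \<Longrightarrow> At l' (Nom l') \<in> L"
  using closedD[OF inst.intros(8)[of l l']] by auto

lemma label_refl: "At l p \<in> L \<Longrightarrow> At l (Nom l) \<in> L"
  using closedD[OF inst.intros(9)[of l p]] by auto

lemma label_cong: "At l p \<in> L \<Longrightarrow> At l (Nom l') \<in> L \<Longrightarrow> At l' p \<in> L"
  using closedD[OF inst.intros(11)[of l p l']] by auto

lemma link_cong: "At l (Ex r (Nom l')) \<in> L \<Longrightarrow> At l' (Nom l'') \<in> L \<Longrightarrow> At l (Ex r (Nom l'')) \<in> L"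
  using closedD[OF inst.intros(12)[of l r l' l'']] by auto

lemma consistent: "At l p \<in> L \<Longrightarrow> At l (Neg p) \<notin> L"
  using closedD[OF inst.intros(14)[of l p]] by auto

text \<open>Together with \<open>sim\<close> this copies \<open>branch_terms\<close> and
  \<open>branch_sim\<close> for a bare set of formulae; \<open>a\<close> keeps the domain
  non-empty.\<close>

definition ts :: "iterm set" where
  "ts = insert a (terms L)"

definition sim :: "(iterm \<times> iterm) set" where
  "sim = {(t, t'). t \<in> ts \<and> t' \<in> ts \<and> (t = t' \<or> At t (Nom t') \<in> L)}"

abbreviation cls :: "iterm \<Rightarrow> iterm set" where
  "cls t \<equiv> sim `` {t}"

text \<open>The values \<open>v\<close> of individuals are a parameter because the two uses differ:
  completeness inserts values that respect f on classes, satisfiability a simple default outside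
  \<open>ts\<close>.\<close>

definition canon :: "(iterm \<Rightarrow> iterm set) \<Rightarrow> (iterm, iterm set) interp" where
  "canon v = \<lparr>domain = ts // sim, ind = v, con = \<lambda>p. {cls t |t. At t (Con p) \<in> L},
     rol = \<lambda>r. {(cls t, cls u) |t u. At t (Ex r (Nom u)) \<in> L}\<rparr>"

lemma ts_label: "At t C \<in> L \<Longrightarrow> t \<in> ts"
  and ts_set_concept: "At t C \<in> L \<Longrightarrow> u \<in> set_concept C \<Longrightarrow> u \<in> ts"
  unfolding ts_def by (auto intro: terms_At terms_set_concept)

lemma equiv_sim: "equiv ts sim"
proof (rule equivI)
  show "sim \<subseteq> ts \<times> ts" "refl_on ts sim" unfolding sim_def refl_on_def by auto
  show "sym sim" unfolding sim_def sym_def using nom_sym by auto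
  show "trans sim"
  proof (rule transI)
    fix t t' t'' assume "(t, t') \<in> sim" "(t', t'') \<in> sim"
    \<comment> \<open>Symmetry turns \<open>t : {t'}\<close> into \<open>t' : {t}\<close>, and
      \<open>CongLabel\<close> then carries \<open>{t''}\<close> from \<open>t'\<close> to
      \<open>t\<close>.\<close>
    then show "(t, t'') \<in> sim" unfolding sim_def using label_cong[of t' _ t] nom_sym[of t t'] by auto
  qed
qed

lemma cls_eq: "t \<in> ts \<Longrightarrow> t' \<in> ts \<Longrightarrow> cls t = cls t' \<longleftrightarrow> t = t' \<or> At t (Nom t') \<in> L"
  using eq_equiv_class_iff[OF equiv_sim] unfolding sim_def by auto

lemma cls_domain: "t \<in> ts \<Longrightarrow> cls t \<in> ts // sim"
  by (rule quotientI)

lemma label_cls: "At t C \<in> L \<Longrightarrow> u \<in> ts \<Longrightarrow> cls t = cls u \<Longrightarrow> At u C \<in> L"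
  using cls_eq ts_label label_cong by metis

text \<open>\<open>CongLabel\<close> moves the source of the link and \<open>CongEx\<close> its
  target.\<close>

lemma link_cls:
  assumes "At t (Ex r (Nom u)) \<in> L" "t' \<in> ts" "u' \<in> ts" "cls t = cls t'" "cls u = cls u'"
  shows "At t' (Ex r (Nom u')) \<in> L"
proof -
  have "At t' (Ex r (Nom u)) \<in> L" using assms label_cls by blast
  moreover have "u \<in> ts" using assms ts_set_concept by fastforce
  ultimately show ?thesis using link_cong cls_eq assms by metis
qed

lemma so_model_canon:
  assumes v: "\<And>t. v t \<in> ts // sim"
  shows "so_model (canon v)"
proof -
  have link: "t \<in> ts" "u \<in> ts" if "At t (Ex r (Nom u)) \<in> L" for t r u
    using that ts_label ts_set_concept by fastforce+
  \<comment> \<open>Consecutive links in the quotient meet in one class, but perhaps at different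
    terms; the first is redirected to the source of the second before \<open>TransRule\<close>
    composes them.\<close>
  have "trans {(cls t, cls u) |t u. At t (Ex r (Nom u)) \<in> L}" for r
  proof (rule transI, clarify)
    fix t u t' u' assume *: "At t (Ex r (Nom u)) \<in> L" "At t' (Ex r (Nom u')) \<in> L" "cls u = cls t'"
    then have "At t (Ex r (Nom t')) \<in> L" using link_cls link by blast
    then show "\<exists>t'' u''. (cls t, cls u') = (cls t'', cls u'') \<and> At t'' (Ex r (Nom u'')) \<in> L"
      using link_trans * by blast
  qed
  then show ?thesis
    using v link ts_label cls_domain unfolding so_model_def canon_def by auto
qed

text \<open>The two halves need each other: for \<open>Neg C\<close> the positive half is the
  negative half for \<open>C\<close>, and the negative half reduces by \<open>NegNeg\<close> to the
  positive half for \<open>C\<close>.\<close>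

lemma truth:
  assumes v: "\<And>t. v t \<in> ts // sim" "\<And>t. t \<in> ts \<Longrightarrow> v t = cls t"
  shows "(At t C \<in> L \<longrightarrow> cls t \<in> ext (canon v) C) \<and> (At t (Neg C) \<in> L \<longrightarrow> cls t \<notin> ext (canon v) C)"
proof (induction C arbitrary: t)
  case (Con p)
  have "False" if "At t (Neg (Con p)) \<in> L" "cls t \<in> ext (canon v) (Con p)"
  proof -
    obtain t' where "cls t = cls t'" "At t' (Con p) \<in> L" using \<open>cls t \<in> _\<close> by (auto simp: canon_def)
    then have "At t (Con p) \<in> L" using label_cls ts_label[OF that(1)] by metis
    then show False using consistent that(1) by blast
  qed
  then show ?case by (auto simp: canon_def)
next
  case (Nom u)
  have "cls t \<in> ext (canon v) (Nom u)" if "At t (Nom u) \<in> L"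
    using that v cls_eq ts_label ts_set_concept by (fastforce simp: canon_def)
  moreover have False if n: "At t (Neg (Nom u)) \<in> L" and "cls t \<in> ext (canon v) (Nom u)"
  proof -
    have ts: "t \<in> ts" "u \<in> ts" using n ts_label ts_set_concept by fastforce+
    then have "cls u = cls t" using that v by (simp add: canon_def)
    then have "At t (Nom u) \<in> L" using label_cls[OF neg_nom[OF n]] ts by blast
    then show False using consistent n by blast
  qed
  ultimately show ?case by blast
next
  case (Neg C)
  then show ?case using neg_neg ts_label cls_domain by (auto simp: canon_def)
next
  case (Or C D)
  then show ?case using or_cases[of t C D] neg_or[of t C D] by auto
next
  case (Ex r C)
  have "cls t \<in> ext (canon v) (Ex r C)" if e: "At t (Ex r C) \<in> L"
  proof -
    obtain m u where m: "m = t \<or> At m (Nom t) \<in> L" and l: "At m (Ex r (Nom u)) \<in> L"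
      and u: "C = Nom u \<or> At u C \<in> L" using witness[OF e] by blast
    have "cls m = cls t" using m e l cls_eq ts_label by blast
    then have "(cls t, cls u) \<in> rol (canon v) r" using l by (auto simp: canon_def)
    moreover have "cls u \<in> ext (canon v) C"
    proof (cases "C = Nom u")
      case True
      have "u \<in> ts" using l ts_set_concept by fastforce
      then show ?thesis using True v by (simp add: canon_def)
    qed (use u Ex in blast)
    ultimately show ?thesis by auto
  qed
  moreover have False if n: "At t (Neg (Ex r C)) \<in> L" and e: "cls t \<in> ext (canon v) (Ex r C)"
  proof -
    have "(x, y) \<in> rol (canon v) r \<longleftrightarrow> (\<exists>t' u. x = cls t' \<and> y = cls u \<and> At t' (Ex r (Nom u)) \<in> L)"
      for x y by (auto simp: canon_def)
    then obtain t' u where *: "cls t = cls t'" "At t' (Ex r (Nom u)) \<in> L" "cls u \<in> ext (canon v) C"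
      using e by auto
    then have "At t (Ex r (Nom u)) \<in> L" using label_cls ts_label[OF n] by metis
    then show False using neg_ex n Ex * by blast
  qed
  ultimately show ?case by blast
qed

end

text \<open>Only the individual variables keep their values, so this works even where blocking
  prevents f from being well defined on classes.\<close>

lemma hintikka_satisfiable:
  assumes T: "is_tableau S T" and B: "branch T B" and H: "hintikka (branch_fmls T B)"
  obtains I :: "(nat, iterm set) interp" and x where "so_model I" "x \<in> domain I" "\<forall>C\<in>S. x \<in> ext I C"
proof -
  interpret hintikka "branch_fmls T B" "root_ind T" by (rule H)
  let ?a = "root_ind T"
  define v where "v t = (if t \<in> ts then cls t else cls ?a)" for t
  define I where "I = \<lparr>domain = domain (canon v), ind = v \<circ> Ind, con = con (canon v), rol = rol (canon v)\<rparr>"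
  have a_ts: "?a \<in> ts" by (simp add: ts_def)
  have v: "v t \<in> ts // sim" "t \<in> ts \<Longrightarrow> v t = cls t" for t
    using a_ts unfolding v_def by (auto intro: cls_domain)
  have m: "so_model (canon v)" by (rule so_model_canon) (rule v)
  then have "so_model I" unfolding so_model_def I_def by (auto simp: canon_def v)
  moreover have "cls ?a \<in> ext I C" if "C \<in> S" for C
  proof -
    have "formulas T [] \<subseteq> branch_fmls T B"
      by (rule formulas_branch[OF branch_root[OF T B]])
    then have "At ?a (map_concept Ind C) \<in> branch_fmls T B"
      using T that unfolding is_tableau_def by auto
    then have "cls ?a \<in> ext (canon v) (map_concept Ind C)" using truth[of v] v by blast
    also have "ext (canon v) (map_concept Ind C) = ext I C"
      by (rule ext_map_concept) (simp_all add: I_def canon_def)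
    finally show ?thesis .
  qed
  moreover have "cls ?a \<in> domain I" using cls_domain[OF a_ts] by (simp add: I_def canon_def)
  ultimately show ?thesis using that by blast
qed

text \<open>Recursion on the value of the argument gives the congruence clause of
  \<open>term_model\<close> by construction, including for terms that are not on the branch.\<close>

primrec rec_ind :: "(iterm \<Rightarrow> 'd) \<Rightarrow> (nat \<Rightarrow> iterm concept \<Rightarrow> 'd \<Rightarrow> 'd) \<Rightarrow> iterm \<Rightarrow> 'd" where
  "rec_ind h g (Ind n) = h (Ind n)"
| "rec_ind h g New = h New"
| "rec_ind h g (Fn r C t) = g r C (rec_ind h g t)"

lemma constructive_completeness: "constructively_complete"
  unfolding constructively_complete_def
proof (intro allI impI)
  fix S T B assume TB: "T \<in> finished_tableaux S \<and> open_branch T B"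
  then have T: "is_tableau S T" and fin: "finished T" and ob: "open_branch T B"
    unfolding finished_tableaux_def by auto
  have b: "branch T B" using ob unfolding open_branch_def by blast
  let ?L = "branch_fmls T B" and ?a = "root_ind T"
  have all_closed: "rule_closed ?L \<rho>" for \<rho>
    unfolding rule_closed_def
  proof (intro allI impI, elim conjE)
    fix Ps Xs assume inst: "inst \<rho> Ps Xs" and "set Ps \<subseteq> ?L"
    then have "applied_on T B \<rho> Ps" using fin ob unfolding finished_def by blast
    then show "\<exists>X\<in>set Xs. X \<subseteq> ?L" using applied_on_conclusion[OF T ob _ inst] by blast
  qed
  have H: "hintikka ?L"
  proof
    fix l r p assume l: "At l (Ex r p) \<in> ?L"
    then have "set [At l (Ex r p)] \<subseteq> ?L" by simp
    then have "\<exists>X\<in>set [{At l (Ex r (Nom (Fn r p l))), At (Fn r p l) p}]. X \<subseteq> ?L"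
      by (rule rule_closedD[OF all_closed inst.intros(4)])
    then show "\<exists>m u. (m = l \<or> At m (Nom l) \<in> ?L) \<and> At m (Ex r (Nom u)) \<in> ?L \<and> (p = Nom u \<or> At u p \<in> ?L)"
      by auto
  qed (rule all_closed)
  interpret hintikka ?L ?a by (rule H)
  have ts: "branch_terms T B = ts" unfolding branch_terms_def ts_def ..
  have sim: "branch_sim T B = sim" unfolding branch_sim_def sim_def ts ..
  have sub: "subterms t \<subseteq> ts" if "t \<in> ts" for t
  proof (cases "t = ?a")
    case True
    then show ?thesis using T by (auto simp: is_tableau_def fresh_def ts_def)
  qed (use that subterms_terms in \<open>auto simp: ts_def\<close>)
  \<comment> \<open>The first premise of \<open>CongFn\<close>. An f-term may enter only as the
    right side of an equality; \<open>SymRule\<close> then makes it a label and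
    \<open>ReflLabel\<close> finishes.\<close>
  have self: "At (Fn r C t) (Nom (Fn r C t)) \<in> ?L" if f: "Fn r C t \<in> ts" for r C t
  proof -
    obtain x where x: "x \<in> B" "Fn r C t \<in> terms (formulas T x)"
      using f root_terms(2)[OF T] unfolding ts_def terms_branch_fmls by auto
    have "Fn r C t \<in> label_terms (formulas T x) \<or> (\<exists>v. At v (Nom (Fn r C t)) \<in> formulas T x)"
      using introduced_term[OF T branch_nodes[OF b x(1)] x(2)] root_terms(1)[OF T] by blast
    then have "Fn r C t \<in> label_terms ?L \<or> (\<exists>v. At v (Nom (Fn r C t)) \<in> ?L)"
      using formulas_branch[OF x(1)] unfolding label_terms_def by blast
    then show ?thesis using label_refl nom_sym unfolding label_terms_def by blast
  qed
  have cong: "cls (Fn r C t) = cls (Fn r C t')"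
    if f: "Fn r C t \<in> ts" "Fn r C t' \<in> ts" and tt': "cls t = cls t'" for r C t t'
  proof -
    have "t \<in> ts" "t' \<in> ts" using sub[OF f(1)] sub[OF f(2)] subterms_refl by auto
    then consider "t = t'" | "At t (Nom t') \<in> ?L" using tt' cls_eq by blast
    then show ?thesis
    proof cases
      case 2
      have "set [At (Fn r C t) (Nom (Fn r C t)), At t (Nom t')] \<subseteq> ?L" using self[OF f(1)] 2 by simp
      then have "\<exists>X\<in>set [{At (Fn r C t) (Nom (Fn r C t'))}]. X \<subseteq> ?L"
        by (rule rule_closedD[OF all_closed inst.intros(13)])
      then show ?thesis using cls_eq f by simp
    qed simp
  qed
  define h where "h t = (if t \<in> ts then cls t else cls ?a)" for t
  \<comment> \<open>Any member of the class \<open>d\<close> whose f-term is on the branch may be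
    taken: \<open>cong\<close> makes the result independent of the choice. Without such a member the
    root class is the default.\<close>
  define g where "g r C d = (if \<exists>t. cls t = d \<and> Fn r C t \<in> ts
    then cls (Fn r C (SOME t. cls t = d \<and> Fn r C t \<in> ts)) else cls ?a)" for r C d
  define v where "v = rec_ind h g"
  have a: "cls ?a \<in> ts // sim" by (rule cls_domain) (simp add: ts_def)
  have g_cls: "g r C (cls t) = cls (Fn r C t)" if f: "Fn r C t \<in> ts" for r C t
  proof -
    let ?P = "\<lambda>t'. cls t' = cls t \<and> Fn r C t' \<in> ts"
    have "?P (SOME t'. ?P t')" by (rule someI[of ?P t]) (simp add: f)
    then have "cls (Fn r C (SOME t'. ?P t')) = cls (Fn r C t)" using cong f by blast
    then show ?thesis using f unfolding g_def by auto
  qed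
  have g_dom: "g r C d \<in> ts // sim" for r C d
  proof (cases "\<exists>t. cls t = d \<and> Fn r C t \<in> ts")
    case True
    then show ?thesis using someI_ex[OF True] unfolding g_def by (auto intro: cls_domain)
  qed (use a in \<open>auto simp: g_def\<close>)
  have v_dom: "v t \<in> ts // sim" for t
    using a g_dom by (cases t) (auto simp: v_def h_def intro: cls_domain)
  have v_cls: "t \<in> ts \<Longrightarrow> v t = cls t" for t
  proof (induction t)
    case (Fn r C t)
    then have "t \<in> ts" using sub subterms_refl by fastforce
    then show ?case using Fn g_cls by (simp add: v_def)
  qed (simp_all add: v_def h_def)
  have "term_model (canon v)"
    using so_model_canon v_dom unfolding term_model_def by (auto simp: canon_def v_def)
  moreover have "domain (canon v) = ts // sim" by (simp add: canon_def)
  moreover have "ind (canon v) t = cls t" if "t \<in> ts" for t using that v_cls by (simp add: canon_def)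
  moreover have "ind (canon v) t \<in> ext (canon v) C" if C: "At t C \<in> ?L" for t C
    using truth[of v t C] v_dom v_cls C ts_label[OF C] by (simp add: canon_def)
  ultimately show "equiv (branch_terms T B) (branch_sim T B) \<and>
        (\<exists>I :: (iterm, iterm set) interp.
           term_model I \<and>
           domain I = branch_terms T B // branch_sim T B \<and>
           (\<forall>t\<in>branch_terms T B. ind I t = branch_sim T B `` {t}) \<and>
           (\<forall>t C. At t C \<in> branch_fmls T B \<longrightarrow> ind I t \<in> ext I C))"
    using equiv_sim unfolding ts sim by blast
qed


section \<open>Termination\<close>

lemma finite_formulas:
  assumes T: "is_tableau S T" and "finite S" and "x \<in> nodes T"
  shows "finite (formulas T x)"
  using T assms(3)
proof (induction x rule: node_induct)
  case root
  then show ?case using T assms(2) by (simp add: is_tableau_def)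
next
  case (child x i \<rho> Ps Xs)
  have "inst \<rho> Ps Xs" using child.hyps by (simp add: expansion_def)
  then have "\<forall>X\<in>set Xs. finite X" by cases auto
  then have "finite (Xs ! i)" using child.hyps by simp
  then show ?case using child by simp
qed

lemma finite_set_concept: "finite (set_concept C)"
  by (induction C) auto

lemma finite_subterms: "finite (subterms t)"
proof (induction t)
  case (Fn r C t)
  then show ?case by (simp add: concept.set_map finite_set_concept)
qed simp_all

lemma finite_terms:
  assumes "finite L"
  shows "finite (terms L)"
proof -
  have "finite (fml_terms F)" for F
    by (cases F) (simp add: finite_subterms finite_set_concept)
  then show ?thesis using assms by (simp add: terms_def)
qed

text \<open>\<open>concept_closure \<Sigma> U\<close> contains the concepts that a tableau with input concepts in \<open>\<Sigma>\<close> can produce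
  from individual terms in \<open>U\<close>.\<close>

definition concept_closure :: "iterm concept set \<Rightarrow> iterm set \<Rightarrow> iterm concept set" where
  "concept_closure \<Sigma> U = \<Sigma> \<union> Neg ` \<Sigma> \<union> Nom ` U \<union> (Neg \<circ> Nom) ` U \<union>
     {Ex r (Nom u) |r u. u \<in> U \<and> (\<exists>p. Ex r p \<in> \<Sigma>)}"

definition input_concepts :: "nat concept set \<Rightarrow> iterm concept set" where
  "input_concepts S = (\<Union>C\<in>S. subconcepts (map_concept Ind C))"

lemma input_concepts_subconcepts: "D \<in> input_concepts S \<Longrightarrow> subconcepts D \<subseteq> input_concepts S"
  using subconcepts_trans unfolding input_concepts_def by blast

lemma finite_input_concepts: "finite S \<Longrightarrow> finite (input_concepts S)"
  unfolding input_concepts_def by (simp add: finite_subconcepts)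

lemma finite_roles:
  assumes "finite \<Sigma>"
  shows "finite {r. \<exists>p. Ex r p \<in> \<Sigma>}"
proof -
  have "{r. \<exists>p. Ex r p \<in> \<Sigma>} \<subseteq> (\<lambda>C. case C of Ex r p \<Rightarrow> r | _ \<Rightarrow> 0) ` \<Sigma>" by force
  then show ?thesis using assms finite_surj by blast
qed

lemma finite_concept_closure:
  assumes "finite \<Sigma>" "finite U"
  shows "finite (concept_closure \<Sigma> U)"
proof -
  have "{Ex r (Nom u) |r u. u \<in> U \<and> (\<exists>p. Ex r p \<in> \<Sigma>)} =
      (\<lambda>(r, u). Ex r (Nom u)) ` ({r. \<exists>p. Ex r p \<in> \<Sigma>} \<times> U)" by auto
  then show ?thesis using assms finite_roles[of \<Sigma>] by (simp add: concept_closure_def)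
qed

text \<open>One layer of negation over \<Sigma> suffices: rules for negated concepts either strip it
  or move it to a smaller subconcept. Taking \<open>UNIV\<close> separates the shape of concepts
  from the question which terms occur.\<close>

lemma inst_concept_closure:
  assumes sub: "\<And>C. C \<in> \<Sigma> \<Longrightarrow> subconcepts C \<subseteq> \<Sigma>"
    and inst: "inst \<rho> Ps Xs"
    and Ps: "\<And>t C. At t C \<in> set Ps \<Longrightarrow> C \<in> concept_closure \<Sigma> UNIV"
    and X: "X \<in> set Xs" "At t C \<in> X"
  shows "C \<in> concept_closure \<Sigma> UNIV"
proof -
  have neg: "D \<in> \<Sigma>" if "Neg D \<in> \<Sigma>" for D
    using sub[OF that] subconcepts_refl by auto
  have ors: "D \<in> \<Sigma>" "E \<in> \<Sigma>" if "Or D E \<in> \<Sigma>" for D E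
    using sub[OF that] subconcepts_refl by auto
  have ex: "D \<in> \<Sigma>" if "Ex r D \<in> \<Sigma>" for r D
    using sub[OF that] subconcepts_refl by auto
  show ?thesis
    using inst
  proof cases
    case (1 l p)
    have "Neg (Neg p) \<in> concept_closure \<Sigma> UNIV" using Ps 1 by simp
    then have "p \<in> \<Sigma>" using neg[of p] neg[of "Neg p"] by (auto simp: concept_closure_def)
    then show ?thesis using 1 X by (simp add: concept_closure_def)
  next
    case (2 l p q)
    have "Or p q \<in> concept_closure \<Sigma> UNIV" using Ps 2 by simp
    then have "p \<in> \<Sigma>" "q \<in> \<Sigma>" using ors[of p q] by (auto simp: concept_closure_def)
    then show ?thesis using 2 X by (auto simp: concept_closure_def)
  next
    case (3 l p q)
    have "Neg (Or p q) \<in> concept_closure \<Sigma> UNIV" using Ps 3 by simp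
    then have "p \<in> \<Sigma>" "q \<in> \<Sigma>" using ors[of p q] neg[of "Or p q"] by (auto simp: concept_closure_def)
    then show ?thesis using 3 X by (auto simp: concept_closure_def)
  next
    case (4 l r p)
    have "Ex r p \<in> concept_closure \<Sigma> UNIV" using Ps 4 by simp
    then have "(\<exists>p. Ex r p \<in> \<Sigma>)" "p \<in> \<Sigma> \<or> p \<in> range Nom" using ex[of r p] by (auto simp: concept_closure_def)
    then show ?thesis using 4 X by (auto simp: concept_closure_def)
  next
    case (5 l r p l')
    have "Neg (Ex r p) \<in> concept_closure \<Sigma> UNIV" using Ps 5 by simp
    then have "p \<in> \<Sigma>" using ex[of r p] neg[of "Ex r p"] by (auto simp: concept_closure_def)
    then show ?thesis using 5 X by (auto simp: concept_closure_def)
  next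
    case (6 l r l' l'')
    have "Ex r (Nom l'') \<in> concept_closure \<Sigma> UNIV" using Ps[of l' "Ex r (Nom l'')"] 6 by simp
    then show ?thesis using 6 X by simp
  next
    case (11 l p l')
    have "p \<in> concept_closure \<Sigma> UNIV" using Ps[of l p] 11 by simp
    then show ?thesis using 11 X by simp
  next
    case (12 l r l' l'')
    have "Ex r (Nom l') \<in> concept_closure \<Sigma> UNIV" using Ps 12 by simp
    then show ?thesis using 12 X by (auto simp: concept_closure_def)
  qed (use X in \<open>auto simp: concept_closure_def\<close>)
qed

lemma tableau_concept_closure:
  assumes T: "is_tableau S T" and "x \<in> nodes T" and "At t C \<in> formulas T x"
  shows "C \<in> concept_closure (input_concepts S) UNIV"
  using assms
proof (induction x arbitrary: t C rule: node_induct)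
  case root
  then have "C \<in> input_concepts S"
    using T subconcepts_refl by (fastforce simp: is_tableau_def input_concepts_def)
  then show ?case by (simp add: concept_closure_def)
next
  case (child x i \<rho> Ps Xs)
  have inst: "inst \<rho> Ps Xs" and Ps: "set Ps \<subseteq> formulas T x" and X: "Xs ! i \<in> set Xs"
    using child.hyps by (auto simp: expansion_def)
  have "D \<in> concept_closure (input_concepts S) UNIV" if "At u D \<in> set Ps" for u D
    using child.IH Ps that by blast
  then have "C \<in> concept_closure (input_concepts S) UNIV" if "At t C \<in> Xs ! i"
    using inst_concept_closure[OF input_concepts_subconcepts inst _ X that] by blast
  then show ?case using child.prems child.hyps child.IH by blast
qed

lemma finite_branch_fmls:
  assumes T: "is_tableau S T" and B: "branch T B" and "finite S"
    and fin: "finite (terms (branch_fmls T B))"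
  shows "finite (branch_fmls T B)"
proof -
  let ?U = "terms (branch_fmls T B)"
  have "branch_fmls T B \<subseteq> (\<lambda>(t, C). At t C) ` (?U \<times> concept_closure (input_concepts S) ?U)"
  proof
    fix F assume F: "F \<in> branch_fmls T B"
    obtain t C where tC: "F = At t C" by (cases F)
    have "C \<in> concept_closure (input_concepts S) UNIV"
      using tableau_concept_closure[OF T branch_nodes[OF B]] F tC by (auto simp: branch_fmls_def)
    moreover have "u \<in> ?U" if "u \<in> set_concept C" for u
      using terms_set_concept F tC that by blast
    ultimately have "C \<in> concept_closure (input_concepts S) ?U"
      by (auto simp: concept_closure_def)
    then show "F \<in> (\<lambda>(t, C). At t C) ` (?U \<times> concept_closure (input_concepts S) ?U)"
      using terms_At F tC by auto
  qed
  then show ?thesis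
    using finite_concept_closure[OF finite_input_concepts[OF assms(3)] fin] fin
    by (meson finite_SigmaI finite_surj)
qed

text \<open>No rule is applied twice to the same premises along a branch, so \<open>applied\<close>
  is injective where it is defined. Rules have at most two premises, which leaves finitely many
  values, and at most one node of the branch has no application.\<close>

lemma finite_branch:
  assumes T: "is_tableau S T" and B: "branch T B" and "finite (branch_fmls T B)"
  shows "finite B"
proof -
  let ?D = "{x \<in> B. applied T x \<noteq> None}"
  let ?A = "(UNIV :: rule_name set) \<times> {Ps. set Ps \<subseteq> branch_fmls T B \<and> length Ps \<le> 2}"
  have leaf: "x = y" if "x \<in> B - ?D" "y \<in> B - ?D" for x y
  proof -
    have no: False if x: "x \<in> B - ?D" and y: "y \<in> B" and "strict_prefix x y" for x y
    proof -
      obtain i where "prefix (x @ [i]) y" using \<open>strict_prefix x y\<close> by (rule strict_prefix_snocE)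
      then have "x @ [i] \<in> nodes T" using node_prefix[OF T branch_nodes[OF B y]] by blast
      then obtain \<rho> Ps where "applied T x = Some (\<rho>, Ps)" using node_child[OF T] by metis
      then show False using x by simp
    qed
    then show ?thesis using that branch_comparable[OF B, of x y] no[of x y] no[of y x]
      unfolding strict_prefix_def by blast
  qed
  have "finite (B - ?D)"
  proof (cases "B - ?D = {}")
    case False
    then obtain x where "x \<in> B - ?D" by blast
    then have "B - ?D \<subseteq> {x}" using leaf by blast
    then show ?thesis by (rule finite_subset) simp
  qed (simp only: finite.emptyI)
  moreover have "finite ?D"
  proof (rule finite_imageD)
    have "applied T ` ?D \<subseteq> Some ` ?A"
    proof
      fix z assume "z \<in> applied T ` ?D"
      then obtain x \<rho> Ps where x: "x \<in> B" "applied T x = Some (\<rho>, Ps)" "z = Some (\<rho>, Ps)" by force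
      obtain Xs where "expansion T x \<rho> Ps Xs" using node_applied[OF T branch_nodes[OF B x(1)] x(2)] .
      then have "inst \<rho> Ps Xs" "set Ps \<subseteq> branch_fmls T B"
        using formulas_branch[OF x(1)] by (auto simp: expansion_def)
      moreover from this(1) have "length Ps \<le> 2" by cases auto
      ultimately show "z \<in> Some ` ?A" using x by blast
    qed
    moreover have "finite (UNIV :: rule_name set)"
    proof -
      have "UNIV = {NegNeg, OrRule, NegOr, ExRule, NegEx, TransRule, SymRule, ReflNegNom, ReflLabel,
          ReflNegEx, CongLabel, CongEx, CongFn, Closure, UB}"
        using rule_name.exhaust by auto
      then show ?thesis by (metis finite.emptyI finite.insertI)
    qed
    ultimately show "finite (applied T ` ?D)"
      using finite_lists_length_le[OF assms(3)] by (meson finite_SigmaI finite_imageI finite_subset)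
    have neq: "applied T x \<noteq> applied T y" if x: "x \<in> ?D" and y: "y \<in> ?D" and xy: "strict_prefix x y" for x y
    proof -
      obtain \<rho> Ps where a: "applied T y = Some (\<rho>, Ps)" using y by auto
      obtain Xs where "expansion T y \<rho> Ps Xs" using node_applied[OF T branch_nodes[OF B] a] y by blast
      then show ?thesis using xy a unfolding expansion_def by metis
    qed
    show "inj_on (applied T) ?D"
    proof (rule inj_onI, rule ccontr)
      fix x y assume x: "x \<in> ?D" "y \<in> ?D" "applied T x = applied T y" "x \<noteq> y"
      then have "strict_prefix x y \<or> strict_prefix y x"
        using branch_comparable[OF B, of x y] by (auto simp: strict_prefix_def)
      then show False using neq[OF x(1,2)] neq[OF x(2,1)] x(3) by auto
    qed
  qed
  ultimately have "finite ((B - ?D) \<union> ?D)" by (rule finite_UnI)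
  moreover have "(B - ?D) \<union> ?D = B" by blast
  ultimately show ?thesis by (simp only:)
qed

section \<open>The order of introduction along a branch\<close>

locale ordered_branch =
  fixes S T B lt
  assumes T: "is_tableau S T" and finite_input: "finite S" and B: "branch T B"
    and order: "introduction_order T B lt"
begin

abbreviation L :: "fml set" where
  "L \<equiv> branch_fmls T B"

lemma lt_trans: "(s, t) \<in> lt \<Longrightarrow> (t, u) \<in> lt \<Longrightarrow> (s, u) \<in> lt"
  and lt_irrefl: "(t, t) \<notin> lt"
  and lt_total: "s \<in> terms L \<Longrightarrow> t \<in> terms L \<Longrightarrow> s \<noteq> t \<Longrightarrow> (s, t) \<in> lt \<or> (t, s) \<in> lt"
  using order
  by (auto simp: introduction_order_def strict_linear_order_on_def total_on_def irrefl_def dest: transD)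

lemma lt_introduced:
  assumes "x \<in> B" "t \<in> terms (formulas T x)" "t' \<in> terms L" "t' \<notin> terms (formulas T x)"
  shows "(t, t') \<in> lt"
  using assms order terms_mono[OF formulas_branch[OF assms(1)]] unfolding introduction_order_def by blast

text \<open>A term below \<open>t\<close> already occurs at every node where \<open>t\<close> does,
  and a single node has only finitely many terms.\<close>

lemma finite_below:
  assumes "t \<in> terms L"
  shows "finite {u \<in> terms L. (u, t) \<in> lt}"
proof -
  obtain x where x: "x \<in> B" "t \<in> terms (formulas T x)" using assms by (auto simp: terms_branch_fmls)
  have "{u \<in> terms L. (u, t) \<in> lt} \<subseteq> terms (formulas T x)"
    using lt_introduced[OF x] lt_trans lt_irrefl by blast
  moreover have "finite (terms (formulas T x))"
    by (intro finite_terms finite_formulas[OF T finite_input] branch_nodes[OF B] x)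
  ultimately show ?thesis by (rule finite_subset)
qed

text \<open>The number of predecessors is finite and strictly monotone along \<open>lt\<close>,
  hence a rank function.\<close>

lemma least:
  assumes "t \<in> A" "A \<subseteq> terms L"
  obtains m where "m \<in> A" "\<And>u. u \<in> A \<Longrightarrow> (u, m) \<notin> lt"
proof -
  let ?f = "\<lambda>t. card {u \<in> terms L. (u, t) \<in> lt}"
  obtain m where m: "m \<in> A" "\<And>u. u \<in> A \<Longrightarrow> ?f m \<le> ?f u"
    using ex_has_least_nat[of "\<lambda>t. t \<in> A" t ?f] assms(1) by blast
  have "(u, m) \<notin> lt" if u: "u \<in> A" for u
  proof
    assume um: "(u, m) \<in> lt"
    have "{v \<in> terms L. (v, u) \<in> lt} \<subset> {v \<in> terms L. (v, m) \<in> lt}"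
      using um u assms(2) lt_trans lt_irrefl by blast
    then have "?f u < ?f m" using finite_below m(1) assms(2) by (intro psubset_card_mono) auto
    then show False using m(2)[OF u] by simp
  qed
  then show ?thesis using that m(1) by blast
qed

end

text \<open>Rules other than \<open>ExRule\<close> and \<open>CongFn\<close> create no terms, so
  \<open>c1\<close> leaves them alone. If \<open>p\<close> is not a nominal, \<open>m\<close> is the
  only main term of \<open>m : \<exists>r.p\<close>, and taking \<open>m\<close> least among the
  terms equated to \<open>l\<close> excludes blocking.\<close>

lemma hintikka_c1:
  assumes "ordered_branch S T B lt" and ob: "open_branch T B"
    and fin: "\<And>\<rho> Ps Xs. inst \<rho> Ps Xs \<Longrightarrow> set Ps \<subseteq> branch_fmls T B \<Longrightarrow> applied_on T B \<rho> Ps \<or>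
     (term_producing (branch_fmls T B) \<rho> Xs \<and> blocked lt (branch_fmls T B) Ps)"
  shows "hintikka (branch_fmls T B)"
proof -
  interpret ordered_branch S T B lt by (rule assms(1))
  have closed: "rule_closed L \<rho>" if \<rho>: "\<rho> \<notin> {ExRule, CongFn}" for \<rho>
    unfolding rule_closed_def
  proof (intro allI impI, elim conjE)
    fix Ps Xs assume inst: "inst \<rho> Ps Xs" and Ps: "set Ps \<subseteq> L"
    have "terms X \<subseteq> terms L" if "X \<in> set Xs" for X
      using new_term_cases[OF inst Ps that] \<rho> by blast
    then have "\<not> term_producing L \<rho> Xs" using \<rho> by (auto simp: term_producing_def terms_def)
    then have "applied_on T B \<rho> Ps" using fin inst Ps by blast
    then show "\<exists>X\<in>set Xs. X \<subseteq> L" using applied_on_conclusion[OF T ob _ inst] by blast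
  qed
  note sym = rule_closedD[OF closed inst.intros(7)]
  note refl = rule_closedD[OF closed inst.intros(9)]
  note cong = rule_closedD[OF closed inst.intros(11)]
  show ?thesis
  proof
    fix l r p assume l: "At l (Ex r p) \<in> L"
    show "\<exists>m u. (m = l \<or> At m (Nom l) \<in> L) \<and> At m (Ex r (Nom u)) \<in> L \<and> (p = Nom u \<or> At u p \<in> L)"
    proof (cases "\<exists>u. p = Nom u")
      case False
      let ?A = "{t. At t (Nom l) \<in> L}"
      have "l \<in> ?A" using refl[of l "Ex r p"] l by auto
      moreover have "?A \<subseteq> terms L" using terms_At by blast
      ultimately obtain m where m: "At m (Nom l) \<in> L" and min: "\<And>u. u \<in> ?A \<Longrightarrow> (u, m) \<notin> lt"
        by (rule least) simp
      have "At l (Nom m) \<in> L" using sym[of m l] m by auto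
      then have lm: "At m (Ex r p) \<in> L" using cong[of l "Ex r p" m] l by auto
      \<comment> \<open>A term that blocks \<open>m\<close> would thus be a smaller element of
        \<open>?A\<close>.\<close>
      have "At u (Nom l) \<in> L" if "At u (Nom m) \<in> L" for u
        using sym[of u m] that cong[of m "Nom l" u] cong[of m "Nom u" l] sym[of l u] m by auto
      then have "\<not> blocked lt L [At m (Ex r p)]"
        using min False by (cases p) (auto simp: blocked_def)
      then have "applied_on T B ExRule [At m (Ex r p)]"
        using fin[OF inst.intros(4)[of m r p]] lm by auto
      then have "At m (Ex r (Nom (Fn r p m))) \<in> L \<and> At (Fn r p m) p \<in> L"
        using applied_on_conclusion[OF T ob _ inst.intros(4)[of m r p]] by auto
      then show ?thesis using m by blast
    qed (use l in blast)
  qed (rule closed)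
qed

lemma main_terms_fml_terms: "main_terms F \<subseteq> fml_terms F"
  using subterms_refl by (induction F rule: main_terms.induct) auto

section \<open>Finitely many terms on a branch true in a finite model\<close>

context ordered_branch
begin

text \<open>On a branch true in a finite model, from the node provided by \<open>c2\<close> onwards, a label that is not
  blocked is the least label with its value. As labels accumulate, these least labels decrease, so each
  of the finitely many values contributes finitely many of them.\<close>

lemma finite_terms_branch:
  assumes J: "so_model J" and finJ: "finite (domain J)" and true: "\<And>F. F \<in> L \<Longrightarrow> holds J F"
    and c1: "\<And>x \<rho> Ps Xs. \<lbrakk>x \<in> B; applied T x = Some (\<rho>, Ps); inst \<rho> Ps Xs;
      term_producing (formulas T x) \<rho> Xs\<rbrakk> \<Longrightarrow> \<not> blocked lt (formulas T x) Ps"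
    and x0: "x0 \<in> B"
    and c2: "\<And>x \<rho> Ps Xs t t'. \<lbrakk>x \<in> B; prefix x0 x; applied T x = Some (\<rho>, Ps); inst \<rho> Ps Xs;
      term_producing (formulas T x) \<rho> Xs; t \<in> label_terms (formulas T x); t' \<in> label_terms (formulas T x)\<rbrakk>
      \<Longrightarrow> \<exists>y. strict_prefix y x \<and> applied T y = Some (UB, [At t (Nom t), At t' (Nom t')])"
  shows "finite (terms L)"
proof -
  define producing where "producing x \<longleftrightarrow> x \<in> B \<and> prefix x0 x \<and>
    (\<exists>\<rho> Ps Xs. applied T x = Some (\<rho>, Ps) \<and> inst \<rho> Ps Xs \<and> term_producing (formulas T x) \<rho> Xs)" for x
  define least_label where "least_label x t \<longleftrightarrow> t \<in> label_terms (formulas T x) \<and>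
    (\<forall>v. At v (Nom t) \<in> formulas T x \<longrightarrow> (v, t) \<notin> lt)" for x t
  define M where "M = {t. \<exists>x. producing x \<and> least_label x t}"
  have mono: "formulas T x \<subseteq> formulas T y" if "prefix x y" "y \<in> B" for x y
    using formulas_mono[OF T that(1) branch_nodes[OF B that(2)]] .
  have label: "t \<in> terms L" if "t \<in> label_terms (formulas T x)" "x \<in> B" for t x
    using that formulas_branch terms_At unfolding label_terms_def by blast
  have ub: "At t (Nom t') \<in> formulas T x"
    if p: "producing x" and t: "t \<in> label_terms (formulas T x)" "t' \<in> label_terms (formulas T x)"
      and eq: "ind J t = ind J t'" for x t t'
  proof -
    let ?Ps = "[At t (Nom t), At t' (Nom t')]"
    have x: "x \<in> B" using p by (simp add: producing_def)
    obtain y where y: "strict_prefix y x" "applied T y = Some (UB, ?Ps)"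
      using p c2 t unfolding producing_def by metis
    obtain i where i: "prefix (y @ [i]) x" using y(1) by (rule strict_prefix_snocE)
    obtain \<rho> Ps Xs where e: "applied T y = Some (\<rho>, Ps)" "expansion T y \<rho> Ps Xs" "i < length Xs"
      "formulas T (y @ [i]) = formulas T y \<union> Xs ! i"
      using node_child[OF T] node_prefix[OF T branch_nodes[OF B x] i] by metis
    have "inst UB ?Ps Xs" using e y by (simp add: expansion_def)
    then have Xs: "Xs = [{At t (Nom t')}, {At t (Neg (Nom t'))}]"
      using inst_functional inst.intros(15) by blast
    have sub: "Xs ! i \<subseteq> formulas T x" using e mono[OF i x] by blast
    \<comment> \<open>The inequality alternative of \<open>UB\<close> is false in \<open>J\<close>,
      so the branch took the equality.\<close>
    have "i \<noteq> 1"
    proof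
      assume "i = 1"
      then have "At t (Neg (Nom t')) \<in> L" using sub Xs formulas_branch[OF x] by auto
      then show False using true eq by fastforce
    qed
    then have "i = 0" using e(3) Xs by simp
    then show ?thesis using sub Xs by simp
  qed
  \<comment> \<open>At the later node \<open>x'\<close> both terms are labels, so \<open>UB\<close>
    has equated them there; a smaller \<open>t\<close> would contradict the leastness of
    \<open>t'\<close>.\<close>
  have not_less: "(t, t') \<notin> lt"
    if "producing x" "least_label x t" "producing x'" "least_label x' t'" "ind J t = ind J t'"
      "length x \<le> length x'" for x t x' t'
  proof -
    have "prefix x x'" using branch_comparable[OF B, of x x'] that prefix_length_le
      unfolding producing_def by (metis append_eq_conv_conj prefixE prefix_length_prefix prefix_order.refl)
    then have "formulas T x \<subseteq> formulas T x'" using mono that by (simp add: producing_def)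
    then have "t \<in> label_terms (formulas T x')" using that unfolding least_label_def label_terms_def by blast
    then have "At t (Nom t') \<in> formulas T x'" using ub that unfolding least_label_def by blast
    then show ?thesis using that unfolding least_label_def by blast
  qed
  have M_terms: "M \<subseteq> terms L" using label unfolding M_def producing_def least_label_def by blast
  have fin_class: "finite {t \<in> M. ind J t = d}" for d
  proof (cases "{t \<in> M. ind J t = d} = {}")
    case False
    let ?P = "\<lambda>(x, t). producing x \<and> least_label x t \<and> ind J t = d"
    obtain z where "?P z" using False unfolding M_def by auto
    \<comment> \<open>Starting from the earliest producing node, \<open>not_less\<close> shows that
      no other member of the class lies above \<open>t\<close>.\<close>
    then obtain w where w: "?P w" and min: "\<And>z. ?P z \<Longrightarrow> length (fst w) \<le> length (fst z)"
      using ex_has_least_nat[of ?P z "\<lambda>z. length (fst z)"] by blast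
    obtain x t where xt: "w = (x, t)" by fastforce
    have t: "t \<in> M" using w xt M_def by auto
    have "{t \<in> M. ind J t = d} \<subseteq> insert t {u \<in> terms L. (u, t) \<in> lt}"
    proof
      fix u assume u: "u \<in> {t \<in> M. ind J t = d}"
      then obtain x' where x': "producing x'" "least_label x' u" unfolding M_def by blast
      then have "(t, u) \<notin> lt" using not_less[of x t x' u] w min[of "(x', u)"] u xt by auto
      then show "u \<in> insert t {u \<in> terms L. (u, t) \<in> lt}"
        using lt_total[of t u] u t M_terms by blast
    qed
    moreover have "finite (insert t {u \<in> terms L. (u, t) \<in> lt})" using finite_below t M_terms by blast
    ultimately show ?thesis by (rule finite_subset)
  qed (simp only: finite.emptyI)
  have "M = (\<Union>d\<in>domain J. {t \<in> M. ind J t = d})" using J unfolding so_model_def by blast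
  then have finM: "finite M" using fin_class finJ by (metis (no_types, lifting) finite_UN_I)
  let ?\<Sigma> = "input_concepts S" and ?U0 = "terms (formulas T x0)"
  \<comment> \<open>\<open>N\<close> will contain the main terms of the premises of every
    term-producing application from \<open>x0\<close> on, and \<open>G\<close> the pairs
    \<open>(r, p)\<close> from which new terms are built. As \<open>N\<close> already accounts for
    the whole branch, one layer of f over it suffices for \<open>W\<close>.\<close>
  define N where "N = ?U0 \<union> M"
  define G where "G = {r. \<exists>p. Ex r p \<in> ?\<Sigma>} \<times> (Nom ` N \<union> ?\<Sigma>) \<union> {(r, p). \<exists>l. Fn r p l \<in> N}"
  define W where "W = ?U0 \<union> (\<lambda>((r, p), l). Fn r p l) ` (G \<times> N)"
  have finU0: "finite ?U0" by (intro finite_terms finite_formulas[OF T finite_input] branch_nodes[OF B] x0)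
  then have finN: "finite N" using finM by (simp add: N_def)
  have fin\<Sigma>: "finite ?\<Sigma>" by (rule finite_input_concepts[OF finite_input])
  have "{(r, p). \<exists>l. Fn r p l \<in> N} \<subseteq> (\<lambda>t. case t of Fn r p l \<Rightarrow> (r, p) | _ \<Rightarrow> undefined) ` N" by force
  then have "finite {(r, p). \<exists>l. Fn r p l \<in> N}" using finN by (rule finite_surj[rotated])
  then have finG: "finite G" using finN fin\<Sigma> finite_roles[OF fin\<Sigma>] by (simp add: G_def)
  have main: "u \<in> N"
    if x: "x \<in> B" "prefix x0 x" and ap: "applied T x = Some (\<rho>, Ps)" and inst: "inst \<rho> Ps Xs"
      and tp: "term_producing (formulas T x) \<rho> Xs" and Ps: "set Ps \<subseteq> formulas T x"
      and F: "F \<in> set Ps" and u: "u \<in> main_terms F" for x \<rho> Ps Xs F u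
  proof -
    have nb: "(v, u) \<notin> lt" if "At v (Nom u) \<in> formulas T x" for v
      using c1[OF x(1) ap inst tp] that F u unfolding blocked_def by blast
    have ux: "u \<in> terms (formulas T x)"
      using F u Ps main_terms_fml_terms unfolding terms_def by blast
    consider "u \<in> terms (formulas T [])" | "u \<in> label_terms (formulas T x)"
      | y i v where "prefix (y @ [i]) x" "u \<notin> terms (formulas T y)" "v \<in> terms (formulas T y)"
        "At v (Nom u) \<in> formulas T x"
      using introduced_term[OF T branch_nodes[OF B x(1)] ux] by blast
    then show ?thesis
    proof cases
      case 1
      then show ?thesis using terms_mono[OF mono[of "[]" x0]] x0 by (auto simp: N_def)
    next
      case 2
      then have "least_label x u" using nb by (simp add: least_label_def)
      moreover have "producing x" using x ap inst tp unfolding producing_def by blast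
      ultimately show ?thesis unfolding N_def M_def by blast
    next
      \<comment> \<open>Impossible: \<open>u\<close> was introduced after \<open>y\<close>, so
        \<open>v\<close> precedes it and \<open>v : {u}\<close> would block the application.\<close>
      case (3 y i v)
      have "prefix y x" using 3(1) by (meson append_prefixD)
      then have "y \<in> B" using branch_prefix[OF T B x(1)] by blast
      moreover have "u \<in> terms L" using ux terms_mono[OF formulas_branch[OF x(1)]] by blast
      ultimately have "(v, u) \<in> lt" using lt_introduced 3 by blast
      then show ?thesis using nb 3 by blast
    qed
  qed
  have "x \<in> B \<longrightarrow> terms (formulas T x) \<subseteq> W" if "x \<in> nodes T" for x
    using T that
  proof (induction x rule: node_induct)
    case root
    then show ?case using terms_mono[OF mono[of "[]" x0]] x0 by (auto simp: W_def)
  next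
    case (child x i \<rho> Ps Xs)
    show ?case
    proof
      assume xi: "x @ [i] \<in> B"
      have x: "x \<in> B" using branch_prefix[OF T B xi, of x] by simp
      show "terms (formulas T (x @ [i])) \<subseteq> W"
      proof (cases "prefix (x @ [i]) x0")
        case True
        then show ?thesis using terms_mono[OF mono[OF True x0]] by (auto simp: W_def)
      next
        case False
        then have "prefix x0 (x @ [i])" using branch_comparable[OF B xi x0] by blast
        then have x0x: "prefix x0 x" using False by (auto simp: prefix_snoc)
        have inst: "inst \<rho> Ps Xs" and Ps: "set Ps \<subseteq> formulas T x" and X: "Xs ! i \<in> set Xs"
          using child.hyps by (auto simp: expansion_def)
        have "u \<in> W" if u: "u \<in> terms (Xs ! i)" and new: "u \<notin> terms (formulas T x)" for u
        proof -
          have "u \<in> terms (\<Union> (set Xs))" using u X terms_mono[of "Xs ! i" "\<Union> (set Xs)"] by blast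
          then have tp: "term_producing (formulas T x) \<rho> Xs" using new by (auto simp: term_producing_def)
          note N = main[OF x x0x \<open>applied T x = Some (\<rho>, Ps)\<close> inst tp Ps]
          show ?thesis
            using inst Ps X u new
          proof (cases rule: new_term_cases)
            case (ExRule l r p)
            have "l \<in> main_terms (At l (Ex r p))" by (cases p) auto
            then have l: "l \<in> N" using N[of "At l (Ex r p)" l] ExRule by simp
            have "Ex r p \<in> concept_closure ?\<Sigma> UNIV"
              using tableau_concept_closure[OF T branch_nodes[OF B x]] Ps ExRule by simp
            then have r: "\<exists>p. Ex r p \<in> ?\<Sigma>" and p: "(\<exists>w. p = Nom w) \<or> Ex r p \<in> ?\<Sigma>"
              by (auto simp: concept_closure_def)
            \<comment> \<open>A nominal \<open>p\<close> could a priori name any term, but in a link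
              that term is a main term and hence in \<open>N\<close>.\<close>
            have "p \<in> Nom ` N \<union> ?\<Sigma>"
            proof (cases "\<exists>w. p = Nom w")
              case True
              then obtain w where "p = Nom w" by blast
              then show ?thesis using N[of "At l (Ex r p)" w] ExRule by simp
            next
              case False
              then have "subconcepts (Ex r p) \<subseteq> ?\<Sigma>" using p input_concepts_subconcepts by blast
              then show ?thesis using subconcepts_refl[of p] by auto
            qed
            then have "(r, p) \<in> G" using r by (simp add: G_def)
            then show ?thesis using l ExRule(3) unfolding W_def by force
          next
            \<comment> \<open>The new term reuses \<open>r\<close> and \<open>p\<close> from the
              main term \<open>f(r,p,l)\<close>, which is why \<open>G\<close> collects such pairs
              from \<open>N\<close>.\<close>
            case (CongFn l l' r p)
            have "Fn r p l \<in> N" using N[of "At (Fn r p l) (Nom (Fn r p l))"] CongFn by simp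
            then have "(r, p) \<in> G" by (auto simp: G_def)
            moreover have "l' \<in> N" using N[of "At l (Nom l')" l'] CongFn by simp
            ultimately show ?thesis using CongFn(3) unfolding W_def by force
          qed
        qed
        then show ?thesis using child.IH x child.hyps by (auto simp: terms_Un)
      qed
    qed
  qed
  then have "terms L \<subseteq> W" using branch_nodes[OF B] unfolding terms_branch_fmls by blast
  moreover have "finite W" using finU0 finG finN by (simp add: W_def)
  ultimately show ?thesis by (rule finite_subset)
qed

end

lemma c1_c2_terminating: "terminating c1_c2_tableaux"
  unfolding terminating_def
proof (intro allI impI, elim conjE, intro conjI impI)
  fix S T assume S: "finite S" and TD: "T \<in> c1_c2_tableaux S"
  obtain lt where T: "is_tableau S T" and order: "\<And>B. branch T B \<Longrightarrow> introduction_order T B (lt B)"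
    and c1: "c1 lt T" and fin: "finished_c1 lt T" and c2: "c2 T"
    using TD unfolding c1_c2_tableaux_def by blast
  show "finite (nodes T)" if "closed_tableau T"
    by (rule closed_tableau_finite[OF T that])
  show "\<exists>B. open_branch T B \<and> finite B" if not_closed: "\<not> closed_tableau T"
  proof -
    have ordered: "ordered_branch S T B (lt B)" if "branch T B" for B
      using T S that order by unfold_locales
    obtain B0 where B0: "open_branch T B0"
      using not_closed unfolding closed_tableau_def open_branch_def by blast
    then have b0: "branch T B0" unfolding open_branch_def by blast
    have "hintikka (branch_fmls T B0)"
      using hintikka_c1[OF ordered[OF b0] B0] fin B0 unfolding finished_c1_def by blast
    then obtain I :: "(nat, iterm set) interp" and x
      where "so_model I" "x \<in> domain I" "\<forall>C\<in>S. x \<in> ext I C"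
      using hintikka_satisfiable[OF T b0] by blast
    then obtain I' :: "(nat, nat concept set) interp" and y
      where I': "so_model I'" "y \<in> domain I'" "\<forall>C\<in>S. y \<in> ext I' C" and finI': "finite (domain I')"
      using finite_model S by metis
    have "fresh S (root_ind T)" using T unfolding is_tableau_def by blast
    then obtain J :: "(iterm, nat concept set) interp" where J: "skolem_model J" "domain J = domain I'"
      "\<forall>C\<in>S. holds J (At (root_ind T) (map_concept Ind C))"
      using skolem_extension[OF I'] by blast
    obtain B where ob: "open_branch T B" and true: "\<And>F. F \<in> branch_fmls T B \<Longrightarrow> holds J F"
      using true_branch[OF T J(1,3)] by blast
    have b: "branch T B" using ob unfolding open_branch_def by blast
    interpret ordered_branch S T B "lt B" by (rule ordered[OF b])
    obtain x0 where x0: "x0 \<in> B" and c2': "\<forall>x\<in>B. \<forall>\<rho> Ps Xs.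
        prefix x0 x \<and> applied T x = Some (\<rho>, Ps) \<and> inst \<rho> Ps Xs \<and> term_producing (formulas T x) \<rho> Xs \<longrightarrow>
        (\<forall>t\<in>label_terms (formulas T x). \<forall>t'\<in>label_terms (formulas T x).
          \<exists>y. strict_prefix y x \<and> applied T y = Some (UB, [At t (Nom t), At t' (Nom t')]))"
      using c2 ob unfolding c2_def by meson
    have "finite (terms L)"
    proof (rule finite_terms_branch)
      show "so_model J" using J(1) unfolding skolem_model_def term_model_def by blast
      show "finite (domain J)" using finI' J(2) by simp
      show "\<not> blocked (lt B) (formulas T x) Ps"
        if "x \<in> B" "applied T x = Some (\<rho>, Ps)" "inst \<rho> Ps Xs" "term_producing (formulas T x) \<rho> Xs"
        for x \<rho> Ps Xs using c1 b that unfolding c1_def by blast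
      show "\<exists>y. strict_prefix y x \<and> applied T y = Some (UB, [At t (Nom t), At t' (Nom t')])"
        if "x \<in> B" "prefix x0 x" "applied T x = Some (\<rho>, Ps)" "inst \<rho> Ps Xs"
          "term_producing (formulas T x) \<rho> Xs" "t \<in> label_terms (formulas T x)"
          "t' \<in> label_terms (formulas T x)"
        for x \<rho> Ps Xs t t' using c2' that by blast
    qed (use true x0 in auto)
    then have "finite L" by (rule finite_branch_fmls[OF T b S])
    then have "finite B" by (rule finite_branch[OF T b])
    then show ?thesis using ob by blast
  qed
qed

theorem theorem8p4:
  shows "sound TYPE('d) \<and> constructively_complete \<and> terminating c1_c2_tableaux"
  using soundness constructive_completeness c1_c2_terminating by blast

end
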